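(* For a ring graph $G$ with $n$ nodes, the $k$-leader selection algorithm for ring graphs (the specific procedure defined in the context: for each initial leader $i\in V$, construct the digraph $\overline G_i$ and find a minimum-weight path from $s_i$ to $t_i$ with at most $k$ edges by the modified Bellman-Ford routine, then take the best result over all $i$) identifies the leader set $S$, with $|S|\le k$, that minimizes $R(S)$, in $O(kn^3)$ time.
   Context: **Problem.** $G=(V,E)$ is a ring graph (cycle) with $V=\{1,\dots,n\}$ numbered in ascending order clockwise around the ring. Each undirected edge $(i,j)\in E$ has a noise parameter $\nu_{ij}=\nu_{ji}>0$ and edge weight $1/\nu_{ij}$. Let $\Delta_i=\sum_{j:(i,j)\in E}1/\nu_{ij}$. The weighted Laplacian $L$ has entries $L_{ij}=-1/\nu_{ij}$ if $(i,j)\in E$, $L_{ii}=\Delta_i$, and $0$ otherwise. For a nonempty leader set $S\subseteq V$, $L_{\mathit{ff}}$ is $L$ with the rows and columns of the nodes in $S$ removed (it is positive definite because $G$ is connected). The total steady-state variance of the leader-follower consensus system is $$R(S)=\sum_{i\in V\setminus S}r_i=\tfrac12\operatorname{tr}(L_{\mathit{ff}}^{-1}),$$ where $r_i=\tfrac12(L_{\mathit{ff}}^{-1})_{ii}$ is the steady-state variance of follower $i$. The trace for an empty matrix is $0$. The $k$-leader selection problem is to minimize $R(S)$ subject to $|S|\le k$. **The algorithm.** Input: $G$, the edge weights $1/\nu_{ij}$, and $k$. *Step 1 (weights).* For all $u,v\in V$ with $u\ne v$, compute $$w_{uv}=\operatorname{tr}\left(M_{(1,\,v-u+1\ (\mathrm{mod}\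 n))}^{-1}\right),$$ where $M$ is obtained from $L$ by cyclically shifting rows and columns so that node $u$ corresponds to the first row and column, $M_{(j,l)}$ is the submatrix of $M$ on rows and columns $j+1,\dots,l-1$, and the residue mod $n$ is taken in $\{1,\dots,n\}$. That is, the submatrix is the one of $L$ indexed by the nodes strictly between $u$ and $v$ going clockwise from $u$ to $v$. It is tridiagonal, and the trace of its inverse is computed in $O(n)$ operations. The weight is $0$ if there are no nodes in between. The weights are stored in a table and looked up in constant time. *Step 2 (digraphs and paths).* For each $i=1,\dots,n$, construct the weighted digraph $\overline G_i=(\overline V_i,\overline E_i,\overline W_i)$ with $\overline V_i=\{s_i,t_i\}\cup(V\setminus\{i\})$, where $s_i$ is a source node and $t_i$ a target node, and with the following edges: - $(s_i,v)$ for every $v\in V\setminus\{i\}$, with weight $w_{iv}$; - $(u,v)$ for $u,v\in V\setminus\{i\}$ such that $u$ precedes $v$ in the clockwise direction (starting from $i$), with weight $w_{uv}$; - $(v,t_i)$ for every $v\in V\setminus\{i\}$, with weight $w_{vi}$. Run the modified Bellman-Ford routine on $\overline G_i$ with source $s_i$, target $t_i$ and bound $H=k$, obtaining a path $P_i$ and its weight $w_i$. *Step 3 (output).* Choose $i$ with $w_i$ minimum. Let $S$ consist of $i$ and the nodes of $P_i$ other than $s_i$ and $t_i$. Return $S$, together with $w_i$ as the error value. **Modified Bellman-Ford routine.** Input: a weighted digraph with edge weights $w(u,v)$, source $s$, target $t$, and a maximum number of edges $H$. Set $d_0(s)=0$ and $d_0(v)=\infty$ for $v\ne s$. For $m=1,\dots,H$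 and every node $v$, set $d_m(v)=\min_u\{d_{m-1}(u)+w(u,v)\}$, the minimum being over nodes $u$ with an edge $(u,v)$ (and $\infty$ if there is none), and record a minimizing $u$ as the predecessor $\pi_m(v)$. Thus $d_m(v)$ is the minimum weight of a path from $s$ to $v$ with exactly $m$ edges. Then, among the computed paths from $s$ to $t$ with $m$ edges, $m=1,\dots,H$, take one of minimum weight, recover its nodes by following the predecessors back from $t$, and return it with its weight. Time is counted in elementary operations (arithmetic, comparisons, memory access), each of cost $O(1)$.
   Formalization: Minimality of R(S) is claimed only for k ≥ 2: for k = 1 the digraphs have no edge from s_i to t_i, so no path with at most one edge exists and the procedure cannot identify the best single leader; |S| ≤ k and the O(kn³) time bound are stated for all k ≥ 1. *)

theory Defs
  imports
    "HOL-Library.Extended_Real"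
    "HOL-Library.Monad_Syntax"
    "Jordan_Normal_Form.Gauss_Jordan_Elimination"
    "Jordan_Normal_Form.DL_Submatrix"
begin

section \<open>The leader selection problem on a ring\<close>

text \<open>The nodes are \<open>1, \<dots>, n\<close>, and the clockwise neighbour of \<open>i\<close> is \<open>i mod n + 1\<close>. Matrices of the
  library are indexed from \<open>0\<close>: node \<open>v\<close> owns row and column \<open>v - 1\<close>.\<close>

definition ring_edge :: "nat \<Rightarrow> nat \<Rightarrow> nat \<Rightarrow> bool" where
  "ring_edge n i j \<longleftrightarrow>
     i \<in> {1..n} \<and> j \<in> {1..n} \<and> (j = i mod n + 1 \<or> i = j mod n + 1)"

definition ring_network :: "nat \<Rightarrow> (nat \<Rightarrow> nat \<Rightarrow> real) \<Rightarrow> bool" where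
  "ring_network n \<nu> \<longleftrightarrow>
     n \<ge> 3 \<and> (\<forall>i j. ring_edge n i j \<longrightarrow> \<nu> i j > 0 \<and> \<nu> i j = \<nu> j i)"

definition laplacian :: "nat \<Rightarrow> (nat \<Rightarrow> nat \<Rightarrow> real) \<Rightarrow> real mat" where
  "laplacian n \<nu> = mat n n (\<lambda>(a, b). let i = Suc a; j = Suc b in
     if i = j then (\<Sum>l | ring_edge n i l. 1 / \<nu> i l)
     else if ring_edge n i j then - 1 / \<nu> i j else 0)"

definition laplacian_ff :: "nat \<Rightarrow> (nat \<Rightarrow> nat \<Rightarrow> real) \<Rightarrow> nat set \<Rightarrow> real mat" where
  "laplacian_ff n \<nu> S = submatrix (laplacian n \<nu>) {a. Suc a \<notin> S} {a. Suc a \<notin> S}"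

definition trace :: "real mat \<Rightarrow> real" where
  "trace A = (\<Sum>i<dim_row A. A $$ (i, i))"

text \<open>For \<open>S\<close> nonempty the matrix is positive definite, so \<^const>\<open>mat_inverse\<close> does return
  \<^const>\<open>Some\<close> inverse (the empty matrix is its own inverse and has trace \<open>0\<close>).\<close>

definition total_variance :: "nat \<Rightarrow> (nat \<Rightarrow> nat \<Rightarrow> real) \<Rightarrow> nat set \<Rightarrow> real" where
  "total_variance n \<nu> S = 1 / 2 * trace (the (mat_inverse (laplacian_ff n \<nu> S)))"


section \<open>Programs with counted elementary operations\<close>

text \<open>A program is the set of its possible executions, each given by the result and the number of
  elementary operations performed. The only source of nondeterminism is \<open>improves\<close> below.\<close>

datatype 'a prog = Prog (execs: "('a \<times> nat) set")

definition ret :: "'a \<Rightarrow> 'a prog" where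
  "ret x = Prog {(x, 0)}"

definition bind_prog :: "'a prog \<Rightarrow> ('a \<Rightarrow> 'b prog) \<Rightarrow> 'b prog" where
  "bind_prog p f = Prog {(y, s + t) | x y s t. (x, s) \<in> execs p \<and> (y, t) \<in> execs (f x)}"

adhoc_overloading Monad_Syntax.bind \<rightleftharpoons> bind_prog

text \<open>In every use below, the argument of \<open>step\<close> performs a single arithmetic operation, a single
  comparison, or a single read, write or allocation of a cell; branching on a value already computed
  is free, and \<open>ret\<close> is only used to pass values on. Arrays are functions; an array write
  is a function update, and the old version of the array is never used again, so that this is an
  update in place.\<close>

definition step :: "'a \<Rightarrow> 'a prog" where
  "step x = Prog {(x, 1)}"

text \<open>Comparison of a candidate \<open>x\<close> with the best value \<open>y\<close> so far when searching for a minimum. On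
  a tie either answer is possible, so a search can end with any of the minimizers.\<close>

definition improves :: "'a::linorder \<Rightarrow> 'a \<Rightarrow> bool prog" where
  "improves x y = Prog {(b, 1) | b. (x < y \<longrightarrow> b) \<and> (b \<longrightarrow> x \<le> y)}"

text \<open>Each iteration and the final exit test cost one operation in addition to the loop body.\<close>

fun foreach :: "'x list \<Rightarrow> ('x \<Rightarrow> 's \<Rightarrow> 's prog) \<Rightarrow> 's \<Rightarrow> 's prog" where
  "foreach [] f s = step s"
| "foreach (x # xs) f s = do { s' \<leftarrow> step s; s'' \<leftarrow> f x s'; foreach xs f s'' }"

text \<open>Uninitialized memory.\<close>

definition fresh :: "'i \<Rightarrow> 'a" where
  "fresh = (\<lambda>_. undefined)"

definition fresh2 :: "'i \<Rightarrow> 'j \<Rightarrow> 'a" where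
  "fresh2 = (\<lambda>_ _. undefined)"

definition upd2 :: "('i \<Rightarrow> 'j \<Rightarrow> 'a) \<Rightarrow> 'i \<Rightarrow> 'j \<Rightarrow> 'a \<Rightarrow> ('i \<Rightarrow> 'j \<Rightarrow> 'a)" where
  "upd2 A i j x = A(i := (A i)(j := x))"


section \<open>Weights\<close>

text \<open>Here \<open>c i j\<close> is the input edge weight \<open>1 / \<nu> i j\<close>. The tables \<open>L\<close> and \<open>M\<close> are indexed from \<open>1\<close>.\<close>

definition laplacian_table ::
    "nat \<Rightarrow> (nat \<Rightarrow> nat \<Rightarrow> real) \<Rightarrow> (nat \<Rightarrow> nat \<Rightarrow> real) prog" where
  "laplacian_table n c =
     foreach [1..<n+1] (\<lambda>i L. do {
       (L, \<Delta>) \<leftarrow> foreach [1..<n+1] (\<lambda>j (L, \<Delta>). do {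
         x \<leftarrow> step (i mod n);
         x \<leftarrow> step (x + 1);
         y \<leftarrow> step (j mod n);
         y \<leftarrow> step (y + 1);
         p \<leftarrow> step (j = x);
         q \<leftarrow> step (i = y);
         e \<leftarrow> step (p \<or> q);
         if e then do {
           a \<leftarrow> step (c i j);
           \<Delta> \<leftarrow> step (\<Delta> + a);
           a \<leftarrow> step (- a);
           L \<leftarrow> step (upd2 L i j a);
           ret (L, \<Delta>)
         } else do {
           L \<leftarrow> step (upd2 L i j 0);
           ret (L, \<Delta>)
         }}) (L, 0);
       step (upd2 L i i \<Delta>)
     }) fresh2"

text \<open>The matrix \<open>M\<close>: row and column \<open>p\<close> belong to the node \<open>p - 1\<close> places clockwise of \<open>u\<close>.\<close>

definition shifted_index :: "nat \<Rightarrow> nat \<Rightarrow> nat \<Rightarrow> nat prog" where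
  "shifted_index n u p = do {
     x \<leftarrow> step (u + p);
     x \<leftarrow> step (x - 2);
     x \<leftarrow> step (x mod n);
     step (x + 1)
   }"

definition shifted_table ::
    "nat \<Rightarrow> (nat \<Rightarrow> nat \<Rightarrow> real) \<Rightarrow> nat \<Rightarrow> (nat \<Rightarrow> nat \<Rightarrow> real) prog" where
  "shifted_table n L u =
     foreach [1..<n+1] (\<lambda>p M. foreach [1..<n+1] (\<lambda>q M. do {
       a \<leftarrow> shifted_index n u p;
       b \<leftarrow> shifted_index n u q;
       x \<leftarrow> step (L a b);
       step (upd2 M p q x)
     }) M) fresh2"

text \<open>The trace of the inverse of the tridiagonal matrix \<open>T\<close> formed by the rows and columns
  \<open>j + 1, \<dots>, l - 1\<close> of \<open>M\<close>. With the pivots of the elimination from the top,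
  \<open>\<delta> p = T p p - T p (p-1) * T (p-1) p / \<delta> (p-1)\<close>, and those of the elimination from the bottom,
  \<open>\<epsilon> p = T p p - T p (p+1) * T (p+1) p / \<epsilon> (p+1)\<close>, the diagonal entries of the inverse are
  \<open>1 / (\<delta> p + \<epsilon> p - T p p)\<close>. In \<open>pivot\<close>, \<open>r\<close> is the index at which the elimination starts and \<open>q\<close> is
  the index treated just before \<open>p\<close>.\<close>

definition pivot ::
    "(nat \<Rightarrow> nat \<Rightarrow> real) \<Rightarrow> nat \<Rightarrow> nat \<Rightarrow> nat \<Rightarrow> (nat \<Rightarrow> real) \<Rightarrow> (nat \<Rightarrow> real) prog" where
  "pivot M r q p \<delta> = do {
     a \<leftarrow> step (M p p);
     b \<leftarrow> step (p = r);
     if b then step (\<delta>(p := a))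
     else do {
       x \<leftarrow> step (M p q);
       y \<leftarrow> step (M q p);
       z \<leftarrow> step (\<delta> q);
       x \<leftarrow> step (x * y);
       x \<leftarrow> step (x / z);
       x \<leftarrow> step (a - x);
       step (\<delta>(p := x))
     }}"

definition tridiagonal_inverse_trace ::
    "(nat \<Rightarrow> nat \<Rightarrow> real) \<Rightarrow> nat \<Rightarrow> nat \<Rightarrow> real prog" where
  "tridiagonal_inverse_trace M j l = do {
     lo \<leftarrow> step (j + 1);
     hi \<leftarrow> step (l - 1);
     \<delta> \<leftarrow> foreach [lo..<l] (\<lambda>p \<delta>. do { q \<leftarrow> step (p - 1); pivot M lo q p \<delta> }) fresh;
     \<epsilon> \<leftarrow> foreach (rev [lo..<l]) (\<lambda>p \<epsilon>. do { q \<leftarrow> step (p + 1); pivot M hi q p \<epsilon> }) fresh;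
     foreach [lo..<l] (\<lambda>p s. do {
       x \<leftarrow> step (\<delta> p);
       y \<leftarrow> step (\<epsilon> p);
       a \<leftarrow> step (M p p);
       x \<leftarrow> step (x + y);
       x \<leftarrow> step (x - a);
       x \<leftarrow> step (1 / x);
       step (s + x)
     }) 0
   }"

text \<open>The index \<open>l\<close> is the residue of \<open>v - u + 1\<close> modulo \<open>n\<close> in \<open>{1..n}\<close>.\<close>

definition weight_table ::
    "nat \<Rightarrow> (nat \<Rightarrow> nat \<Rightarrow> real) \<Rightarrow> (nat \<Rightarrow> nat \<Rightarrow> real) prog" where
  "weight_table n L =
     foreach [1..<n+1] (\<lambda>u w. do {
       M \<leftarrow> shifted_table n L u;
       foreach [1..<n+1] (\<lambda>v w. do {
         b \<leftarrow> step (u = v);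
         if b then ret w
         else do {
           x \<leftarrow> step (v + n);
           x \<leftarrow> step (x - u);
           x \<leftarrow> step (x mod n);
           l \<leftarrow> step (x + 1);
           y \<leftarrow> tridiagonal_inverse_trace M 1 l;
           step (upd2 w u v y)
         }}) w
     }) fresh2"


section \<open>Digraphs and shortest paths\<close>

text \<open>The vertices of the digraph for \<open>i\<close>: the source \<open>s\<^sub>i\<close>, the target \<open>t\<^sub>i\<close>, and the nodes of the ring
  other than \<open>i\<close>.\<close>

datatype vertex = Source | Target | Node nat

text \<open>The number of clockwise steps from \<open>i\<close> to \<open>u\<close>.\<close>

definition clockwise_offset :: "nat \<Rightarrow> nat \<Rightarrow> nat \<Rightarrow> nat prog" where
  "clockwise_offset n i u = do {
     x \<leftarrow> step (u + n);
     x \<leftarrow> step (x - i);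
     step (x mod n)
   }"

text \<open>Whether there is an edge between the two vertices, and its weight (if there is none, \<open>0\<close> is
  stored as the weight and never read).\<close>

fun edge_entry ::
    "nat \<Rightarrow> (nat \<Rightarrow> nat \<Rightarrow> real) \<Rightarrow> nat \<Rightarrow> vertex \<Rightarrow> vertex \<Rightarrow> (bool \<times> real) prog" where
  "edge_entry n w i Source (Node v) = do { x \<leftarrow> step (w i v); step (True, x) }"
| "edge_entry n w i (Node u) (Node v) = do {
     a \<leftarrow> clockwise_offset n i u;
     b \<leftarrow> clockwise_offset n i v;
     e \<leftarrow> step (a < b);
     if e then do { x \<leftarrow> step (w u v); step (True, x) } else step (False, 0) }"
| "edge_entry n w i (Node v) Target = do { x \<leftarrow> step (w v i); step (True, x) }"
| "edge_entry n w i _ _ = step (False, 0)"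

definition ring_digraph ::
    "nat \<Rightarrow> (nat \<Rightarrow> nat \<Rightarrow> real) \<Rightarrow> nat \<Rightarrow>
     (vertex list \<times> (vertex \<Rightarrow> vertex \<Rightarrow> bool) \<times> (vertex \<Rightarrow> vertex \<Rightarrow> real)) prog" where
  "ring_digraph n w i = do {
     V \<leftarrow> foreach [1..<n+1] (\<lambda>v V. do {
       b \<leftarrow> step (v = i);
       if b then ret V else step (Node v # V)
     }) [Source, Target];
     (E, W) \<leftarrow> foreach V (\<lambda>a EW. foreach V (\<lambda>b (E, W). do {
       (e, x) \<leftarrow> edge_entry n w i a b;
       E \<leftarrow> step (upd2 E a b e);
       W \<leftarrow> step (upd2 W a b x);
       ret (E, W)
     }) EW) (fresh2, fresh2);
     ret (V, E, W)
   }"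

text \<open>Here \<open>d m v\<close> is \<open>d\<^sub>m(v)\<close> and \<open>\<pi> m v\<close> is the recorded predecessor. If no path from \<open>s\<close> to \<open>t\<close> with
  at most \<open>H\<close> edges exists, the result is the empty path with weight \<open>\<infinity>\<close>. This happens in the ring
  digraphs for \<open>H = 1\<close>, as they have no edge from \<open>s\<^sub>i\<close> to \<open>t\<^sub>i\<close>.\<close>

definition bellman_ford ::
    "'v list \<Rightarrow> ('v \<Rightarrow> 'v \<Rightarrow> bool) \<Rightarrow> ('v \<Rightarrow> 'v \<Rightarrow> real) \<Rightarrow> 'v \<Rightarrow> 'v \<Rightarrow> nat \<Rightarrow>
     ('v list \<times> ereal) prog" where
  "bellman_ford V E W s t H = do {
     d \<leftarrow> foreach V (\<lambda>v d. do {
       b \<leftarrow> step (v = s);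
       if b then step (upd2 d 0 v 0) else step (upd2 d 0 v \<infinity>)
     }) fresh2;
     (d, \<pi>) \<leftarrow> foreach [1..<H+1] (\<lambda>m d\<pi>. foreach V (\<lambda>v (d, \<pi>). do {
       (x, p) \<leftarrow> foreach V (\<lambda>u (x, p). do {
         e \<leftarrow> step (E u v);
         if e then do {
           a \<leftarrow> step (W u v);
           m' \<leftarrow> step (m - 1);
           y \<leftarrow> step (d m' u);
           y \<leftarrow> step (y + ereal a);
           b \<leftarrow> improves y x;
           if b then step (y, u) else ret (x, p)
         } else ret (x, p)
       }) (\<infinity>, undefined);
       d \<leftarrow> step (upd2 d m v x);
       \<pi> \<leftarrow> step (upd2 \<pi> m v p);
       ret (d, \<pi>)
     }) d\<pi>) (d, fresh2);
     (x, h) \<leftarrow> foreach [1..<H+1] (\<lambda>m (x, h). do {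
       y \<leftarrow> step (d m t);
       b \<leftarrow> improves y x;
       if b then step (y, m) else ret (x, h)
     }) (\<infinity>, 0);
     b \<leftarrow> step (x = \<infinity>);
     if b then ret ([], \<infinity>)
     else do {
       (v, P) \<leftarrow> foreach (rev [1..<h+1]) (\<lambda>m (v, P). do {
         u \<leftarrow> step (\<pi> m v);
         P \<leftarrow> step (u # P);
         ret (u, P)
       }) (t, [t]);
       ret (P, x)
     }}"


section \<open>The selection algorithm\<close>

definition ring_leader_selection ::
    "nat \<Rightarrow> (nat \<Rightarrow> nat \<Rightarrow> real) \<Rightarrow> nat \<Rightarrow> (nat list \<times> ereal) prog" where
  "ring_leader_selection n c k = do {
     L \<leftarrow> laplacian_table n c;
     w \<leftarrow> weight_table n L;
     (P, \<omega>) \<leftarrow> foreach [1..<n+1] (\<lambda>i (P, \<omega>). do {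
       (V, E, W) \<leftarrow> ring_digraph n w i;
       (p, x) \<leftarrow> bellman_ford V E W Source Target k;
       P \<leftarrow> step (P(i := p));
       \<omega> \<leftarrow> step (\<omega>(i := x));
       ret (P, \<omega>)
     }) (fresh, fresh);
     x \<leftarrow> step (\<omega> 1);
     (i, x) \<leftarrow> foreach [2..<n+1] (\<lambda>j (i, x). do {
       y \<leftarrow> step (\<omega> j);
       b \<leftarrow> improves y x;
       if b then step (j, y) else ret (i, x)
     }) (1, x);
     p \<leftarrow> step (P i);
     S \<leftarrow> foreach p (\<lambda>a S. case a of Node v \<Rightarrow> step (v # S) | _ \<Rightarrow> step S) [i];
     ret (S, x)
   }"

end

theory Submission
  imports Defs "Jordan_Normal_Form.Determinant"
begin

text \<open>Cutting the ring at a leader \<open>i\<close> turns it into a line on which node \<open>p\<close> steps clockwise of \<open>i\<close> sits at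
  the resistance coordinate \<open>R p\<close>. In this coordinate the inverse of the grounded Laplacian is the
  explicit piecewise linear Green function of the intervals between consecutive leaders, so a follower
  \<open>q\<close> between the leaders \<open>a < b\<close> contributes \<open>(R q - R a) (R b - R q) / (R b - R a)\<close> to the trace. The
  trace is therefore the weight of the path through the leaders in the digraph of \<open>i\<close>, every leader
  set with at least two elements containing \<open>i\<close> arises from such a path, and the Bellman-Ford routine
  minimizes over these paths. A single leader is never better than two, since splitting an interval
  lowers every contribution.\<close>

section \<open>Reasoning about programs\<close>

text \<open>In circuit terms \<open>\<nu>\<close> is a resistance and the leaders are grounded. The
  diagonal entry of the inverse at a follower is its effective resistance to ground: two resistors
  in parallel, one towards each neighbouring leader. Knowing the inverse replaces any argument about
  definiteness, as the candidate is multiplied out and a right inverse of a square matrix is its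
  inverse. Cutting at \<open>i\<close> puts \<open>i\<close> at both ends, at the offsets
  \<open>0\<close> and \<open>n\<close>. The corner entries of the cyclic matrix do no harm because
  the potential is zero at both ends. A path with \<open>m\<close> edges encodes \<open>m\<close>
  leaders, since source and target stand for the same node. No edge joins source and target, so sets
  with a single leader never occur in a search and are treated apart. For \<open>k = 1\<close> every
  search even returns the empty path with weight \<open>\<infinity>\<close>, which is why optimality
  is claimed from \<open>k = 2\<close> on. Ties may be resolved either way, so the invariants never
  say which minimizer is stored, only that it attains the minimum.\<close>

text \<open>\<open>Q\<close> also sees the operations counted so far, starting from \<open>t\<close>. Counting upwards makes the rules for
  the program constructs equations.\<close>

definition wp :: "'a prog \<Rightarrow> ('a \<Rightarrow> nat \<Rightarrow> bool) \<Rightarrow> nat \<Rightarrow> bool" where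
  "wp p Q t \<longleftrightarrow> (\<forall>x s. (x, s) \<in> execs p \<longrightarrow> Q x (t + s))"

definition spec :: "'a prog \<Rightarrow> nat \<Rightarrow> ('a \<Rightarrow> bool) \<Rightarrow> bool" where
  "spec p T Q \<longleftrightarrow> (\<forall>x s. (x, s) \<in> execs p \<longrightarrow> Q x \<and> s \<le> T)"

lemma wp_ret [simp]: "wp (ret x) Q t = Q x t"
  by (simp add: wp_def ret_def)

lemma wp_step [simp]: "wp (step x) Q t = Q x (Suc t)"
  by (simp add: wp_def step_def)

lemma wp_improves [simp]:
  "wp (improves x y) Q t = (\<forall>b. (x < y \<longrightarrow> b) \<and> (b \<longrightarrow> x \<le> y) \<longrightarrow> Q b (Suc t))"
  by (auto simp: wp_def improves_def)

lemma wp_bind [simp]: "wp (bind_prog p f) Q t = wp p (\<lambda>x s. wp (f x) Q s) t"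
proof -
  have "(y, r) \<in> execs (bind_prog p f) \<longleftrightarrow>
      (\<exists>x s s'. (x, s) \<in> execs p \<and> (y, s') \<in> execs (f x) \<and> r = s + s')" for y r
    by (auto simp: bind_prog_def)
  then show ?thesis
    unfolding wp_def by (simp add: add.assoc) blast
qed

lemma wp_if [simp]: "wp (if b then p else q) Q t = (if b then wp p Q t else wp q Q t)"
  by (cases b) simp_all

lemma wp_case_prod [simp]:
  "wp (case z of (a, b) \<Rightarrow> f a b) Q t = (case z of (a, b) \<Rightarrow> wp (f a b) Q t)"
  by (cases z) simp

lemma specI: "wp p (\<lambda>x s. Q x \<and> s \<le> T) 0 \<Longrightarrow> spec p T Q"
  by (simp add: wp_def spec_def)

lemma spec_weaken: "spec p T Q \<Longrightarrow> T \<le> T' \<Longrightarrow> (\<And>x. Q x \<Longrightarrow> Q' x) \<Longrightarrow> spec p T' Q'"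
  unfolding spec_def by (meson order_trans)

text \<open>A subroutine enters a larger proof only through its contract: the exact count is
  forgotten and an upper bound is kept.\<close>

lemma wp_spec:
  assumes "spec p T Q" "\<And>x s. Q x \<Longrightarrow> s \<le> t + T \<Longrightarrow> R x s"
  shows "wp p R t"
  using assms unfolding wp_def spec_def by simp

text \<open>Every iteration pays one operation beyond its body, and the exit test one more; this is
  the shape of all time bounds below.\<close>

lemma spec_foreach:
  assumes "I 0 s"
    and "\<And>j s. j < length xs \<Longrightarrow> I j s \<Longrightarrow> spec (f (xs ! j) s) B (I (Suc j))"
  shows "spec (foreach xs f s) (length xs * (B + 1) + 1) (I (length xs))"
  using assms
proof (induction xs arbitrary: I s)
  case Nil
  then show ?case by (simp add: spec_def step_def)
next
  case (Cons x xs)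
  have 1: "spec (f x s) B (I (Suc 0))"
    using Cons.prems(2)[of 0 s] Cons.prems(1) by simp
  \<comment> \<open>The tail sees the invariant shifted by one iteration, so the induction must
    leave \<open>I\<close> arbitrary.\<close>
  have 2: "spec (foreach xs f s') (length xs * (B + 1) + 1) (I (Suc (length xs)))"
    if "I (Suc 0) s'" for s'
    using Cons.IH[of "\<lambda>j. I (Suc j)" s'] Cons.prems(2)[of "Suc _"] that by simp
  have "wp (f x s) (\<lambda>u k. wp (foreach xs f u)
      (\<lambda>u k. I (Suc (length xs)) u \<and> k \<le> Suc (length xs) * (B + 1) + 1) k) (Suc 0)"
    by (rule wp_spec[OF 1], rule wp_spec[OF 2]) auto
  then show ?case
    by (intro specI) simp
qed

text \<open>For loops over a vertex list, whose order is irrelevant: the invariant sees only the set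
  of elements already treated. Since \<open>x\<close> may lie in \<open>A\<close>, repeated entries
  are covered.\<close>

lemma spec_foreach_set:
  assumes "I {} s"
    and "\<And>A x s. x \<in> set xs \<Longrightarrow> A \<subseteq> set xs \<Longrightarrow> I A s \<Longrightarrow> spec (f x s) B (I (insert x A))"
  shows "spec (foreach xs f s) (length xs * (B + 1) + 1) (I (set xs))"
proof -
  have "spec (foreach xs f s) (length xs * (B + 1) + 1) (I (set (take (length xs) xs)))"
  proof (rule spec_foreach)
    fix j s
    assume "j < length xs" "I (set (take j xs)) s"
    then have "spec (f (xs ! j) s) B (I (insert (xs ! j) (set (take j xs))))"
      by (intro assms(2)) (auto dest: in_set_takeD)
    then show "spec (f (xs ! j) s) B (I (set (take (Suc j) xs)))"
      using \<open>j < length xs\<close> by (simp add: take_Suc_conv_app_nth)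
  qed (use assms(1) in simp)
  then show ?thesis by simp
qed

lemma spec_foreach_upt:
  assumes "I a s" "a \<le> b"
    and "\<And>j s. a \<le> j \<Longrightarrow> j < b \<Longrightarrow> I j s \<Longrightarrow> spec (f j s) B (I (Suc j))"
  shows "spec (foreach [a..<b] f s) ((b - a) * (B + 1) + 1) (I b)"
  using spec_foreach[of "\<lambda>j. I (a + j)" s "[a..<b]" f B] assms by simp

lemma spec_foreach_rev_upt:
  assumes "I b s" "a \<le> b"
    and "\<And>j s. a \<le> j \<Longrightarrow> j < b \<Longrightarrow> I (Suc j) s \<Longrightarrow> spec (f j s) B (I j)"
  shows "spec (foreach (rev [a..<b]) f s) ((b - a) * (B + 1) + 1) (I a)"
proof -
  have "spec (f (rev [a..<b] ! j) s) B (I (b - Suc j))" if "j < b - a" "I (b - j) s" for j s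
    using that assms(3)[of "b - Suc j" s] by (simp add: rev_nth Suc_diff_Suc)
  then show ?thesis
    using spec_foreach[of "\<lambda>j. I (b - j)" s "rev [a..<b]" f B] assms by simp
qed

text \<open>The obligation for the body is again a \<open>wp\<close>, started at \<open>0\<close>,
  so that the simplifier can run the body and add up its cost.\<close>

lemma wp_foreach_upt:
  assumes "I a s" "a \<le> b"
    and "\<And>j s. a \<le> j \<Longrightarrow> j < b \<Longrightarrow> I j s \<Longrightarrow> wp (f j s) (\<lambda>x r. I (Suc j) x \<and> r \<le> B) 0"
    and "\<And>x r. I b x \<Longrightarrow> r \<le> t + ((b - a) * (B + 1) + 1) \<Longrightarrow> Q x r"
  shows "wp (foreach [a..<b] f s) Q t"
  by (rule wp_spec[OF spec_foreach_upt[where I = I and B = B]]) (use assms in \<open>auto intro: specI\<close>)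

lemma wp_foreach_rev_upt:
  assumes "I b s" "a \<le> b"
    and "\<And>j s. a \<le> j \<Longrightarrow> j < b \<Longrightarrow> I (Suc j) s \<Longrightarrow> wp (f j s) (\<lambda>x r. I j x \<and> r \<le> B) 0"
    and "\<And>x r. I a x \<Longrightarrow> r \<le> t + ((b - a) * (B + 1) + 1) \<Longrightarrow> Q x r"
  shows "wp (foreach (rev [a..<b]) f s) Q t"
  by (rule wp_spec[OF spec_foreach_rev_upt[where I = I and B = B]]) (use assms in \<open>auto intro: specI\<close>)

lemma wp_foreach_set:
  assumes "I {} s"
    and "\<And>A x s. x \<in> set xs \<Longrightarrow> A \<subseteq> set xs \<Longrightarrow> I A s \<Longrightarrow>
      wp (f x s) (\<lambda>y r. I (insert x A) y \<and> r \<le> B) 0"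
    and "\<And>x r. I (set xs) x \<Longrightarrow> r \<le> t + (length xs * (B + 1) + 1) \<Longrightarrow> Q x r"
  shows "wp (foreach xs f s) Q t"
  by (rule wp_spec[OF spec_foreach_set[where I = I and B = B]]) (use assms in \<open>auto intro: specI\<close>)

section \<open>Existence of executions\<close>

lemma execs_ret [simp]: "execs (ret x) \<noteq> {}"
  by (simp add: ret_def)

lemma execs_step [simp]: "execs (step x) \<noteq> {}"
  by (simp add: step_def)

lemma execs_improves [simp]: "execs (improves x y) \<noteq> {}"
proof -
  have "(x < y, 1) \<in> execs (improves x y)"
    by (auto simp: improves_def)
  then show ?thesis by blast
qed

lemma execs_bind:
  assumes "execs p \<noteq> {}" "\<And>x. execs (f x) \<noteq> {}"
  shows "execs (bind_prog p f) \<noteq> {}"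
proof -
  obtain x s where 1: "(x, s) \<in> execs p"
    using assms(1) by auto
  moreover obtain y t where "(y, t) \<in> execs (f x)"
    using assms(2)[of x] by auto
  ultimately have "(y, s + t) \<in> execs (bind_prog p f)"
    unfolding bind_prog_def prog.sel by blast
  then show ?thesis by blast
qed

lemma execs_foreach:
  "(\<And>x s. execs (f x s) \<noteq> {}) \<Longrightarrow> execs (foreach xs f s) \<noteq> {}"
proof (induction xs arbitrary: s)
  case Nil
  then show ?case by simp
next
  case (Cons x xs)
  then show ?case unfolding foreach.simps by (intro execs_bind execs_step) (rule Cons.prems, rule Cons.IH, rule Cons.prems)
qed

lemma execs_if: "execs p \<noteq> {} \<Longrightarrow> execs q \<noteq> {} \<Longrightarrow> execs (if b then p else q) \<noteq> {}"
  by simp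

lemma execs_case_prod: "(\<And>a b. execs (f a b) \<noteq> {}) \<Longrightarrow> execs (case z of (a, b) \<Rightarrow> f a b) \<noteq> {}"
  by (simp split: prod.split)

lemma execs_case_vertex:
  "execs p \<noteq> {} \<Longrightarrow> execs q \<noteq> {} \<Longrightarrow> (\<And>v. execs (f v) \<noteq> {}) \<Longrightarrow>
    execs (case a of Source \<Rightarrow> p | Target \<Rightarrow> q | Node v \<Rightarrow> f v) \<noteq> {}"
  by (simp split: vertex.split)

lemmas execs_intros = execs_ret execs_step execs_improves execs_bind execs_foreach execs_if
  execs_case_prod execs_case_vertex

lemma execs_edge_entry: "execs (edge_entry n w i a b) \<noteq> {}"
proof (cases a; cases b)
qed (simp_all only: edge_entry.simps clockwise_offset_def, (intro execs_intros)+)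

text \<open>Keeps claims about all executions from holding vacuously.\<close>

lemma execs_ring_leader_selection: "execs (ring_leader_selection n c k) \<noteq> {}"
  unfolding ring_leader_selection_def laplacian_table_def weight_table_def shifted_table_def
    shifted_index_def tridiagonal_inverse_trace_def pivot_def ring_digraph_def bellman_ford_def
  by (intro execs_intros execs_edge_entry)


section \<open>The inverse of the grounded Laplacian\<close>

text \<open>The index set in \<open>laplacian_ff\<close> is bounded only by the dimension of the
  matrix and is infinite for finite \<open>S\<close>, so the enumeration is compared with
  \<open>I\<close> below \<open>n\<close>. The inverse map counts the smaller elements of
  \<open>I\<close>.\<close>

lemma bij_betw_pick:
  "bij_betw (pick I) {..<card {a. a < n \<and> a \<in> I}} {a. a < n \<and> a \<in> I}"
proof -
  have le: "p < card I \<or> infinite I" if "p < card {a. a < n \<and> a \<in> I}" for p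
    using that card_mono[of I "{a. a < n \<and> a \<in> I}"] by fastforce
  show ?thesis
  proof (rule bij_betwI[where g = "\<lambda>a. card {b \<in> I. b < a}"])
    show "pick I \<in> {..<card {a. a < n \<and> a \<in> I}} \<rightarrow> {a. a < n \<and> a \<in> I}"
      using pick_le pick_in_set(1) le by auto
    show "(\<lambda>a. card {b \<in> I. b < a}) \<in> {a. a < n \<and> a \<in> I} \<rightarrow> {..<card {a. a < n \<and> a \<in> I}}"
      by (auto intro!: psubset_card_mono)
  qed (use le card_pick in \<open>auto simp: pick_card_in_set\<close>)
qed

lemma mat_inverse_eq_Some:
  fixes A B :: "real mat"
  assumes A: "A \<in> carrier_mat m m" and B: "B \<in> carrier_mat m m" and AB: "A * B = 1\<^sub>m m"
  shows "mat_inverse A = Some B"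
proof -
  have BA: "B * A = 1\<^sub>m m"
    by (rule mat_mult_left_right_inverse[OF A B AB])
  have "A \<in> Units (ring_mat TYPE(real) m undefined)"
    using A B AB BA by (auto simp: Units_def ring_mat_def)
  then obtain C where C: "mat_inverse A = Some C"
    using mat_inverse(1)[OF A] by fastforce
  then have "C * A = 1\<^sub>m m" "C \<in> carrier_mat m m"
    using mat_inverse(2)[OF A] by auto
  then have "C = B"
    using A B AB assoc_mult_mat[of C m m A m B m] by simp
  with C show ?thesis by simp
qed

text \<open>Allows the inverse to be guessed, with \<open>g\<close> indexed by the rows and columns
  of the full matrix instead of positions in the submatrix.\<close>

lemma trace_mat_inverse_submatrix:
  fixes l g :: "nat \<Rightarrow> nat \<Rightarrow> real"
  assumes inv: "\<And>a b. a < n \<Longrightarrow> b < n \<Longrightarrow> a \<in> I \<Longrightarrow> b \<in> I \<Longrightarrow>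
      (\<Sum>c | c < n \<and> c \<in> I. l a c * g c b) = (if a = b then 1 else 0)"
  shows "trace (the (mat_inverse (submatrix (mat n n (\<lambda>(a, b). l a b)) I I))) =
    (\<Sum>a | a < n \<and> a \<in> I. g a a)"
proof -
  define J where "J = {a. a < n \<and> a \<in> I}"
  define m where "m = card J"
  have pick: "bij_betw (pick I) {..<m} J"
    unfolding J_def m_def by (rule bij_betw_pick)
  then have J: "pick I p \<in> J" if "p < m" for p
    using that by (auto simp: bij_betw_def)
  then have J': "pick I p < n" "pick I p \<in> I" if "p < m" for p
    using that by (auto simp: J_def)
  define A where "A = mat m m (\<lambda>(p, q). l (pick I p) (pick I q))"
  define B where "B = mat m m (\<lambda>(p, q). g (pick I p) (pick I q))"
  have sub: "submatrix (mat n n (\<lambda>(a, b). l a b)) I I = A"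
    by (rule eq_matI) (auto simp: submatrix_def A_def J' m_def[unfolded J_def])
  have "A * B = 1\<^sub>m m"
  proof (rule eq_matI)
    fix p q
    assume "p < dim_row (1\<^sub>m m :: real mat)" "q < dim_col (1\<^sub>m m :: real mat)"
    then have pq: "p < m" "q < m" by auto
    have "(A * B) $$ (p, q) = (\<Sum>k<m. l (pick I p) (pick I k) * g (pick I k) (pick I q))"
      using pq by (simp add: A_def B_def scalar_prod_def atLeast0LessThan)
    also have "\<dots> = (\<Sum>c\<in>J. l (pick I p) c * g c (pick I q))"
      by (rule sum.reindex_bij_betw[OF pick])
    also have "\<dots> = (if p = q then 1 else 0)"
      using inv[of "pick I p" "pick I q"] J'[OF pq(1)] J'[OF pq(2)]
        inj_onD[OF bij_betw_imp_inj_on[OF pick], of p q] pq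
      unfolding J_def by auto
    finally show "(A * B) $$ (p, q) = 1\<^sub>m m $$ (p, q)"
      using pq by simp
  qed (auto simp: A_def B_def)
  then have "mat_inverse A = Some B"
    by (intro mat_inverse_eq_Some[of A m B]) (auto simp: A_def B_def)
  then have "trace (the (mat_inverse A)) = (\<Sum>p<m. g (pick I p) (pick I p))"
    by (simp add: trace_def B_def)
  also have "\<dots> = (\<Sum>a\<in>J. g a a)"
    by (rule sum.reindex_bij_betw[OF pick])
  finally show ?thesis
    by (simp add: sub J_def)
qed


section \<open>Clockwise offsets from a fixed node\<close>

text \<open>Offsets are not reduced: for a node \<open>i\<close>, both \<open>0\<close> and
  \<open>n\<close> lead to \<open>i\<close>, the two ends of the cut ring.
  \<open>ring_offset\<close> returns the reduced one.\<close>

definition ring_node :: "nat \<Rightarrow> nat \<Rightarrow> nat \<Rightarrow> nat" where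
  "ring_node n i p = (i + p - 1) mod n + 1"

definition ring_offset :: "nat \<Rightarrow> nat \<Rightarrow> nat \<Rightarrow> nat" where
  "ring_offset n i v = (v + n - i) mod n"

lemma ring_node_in: "n \<ge> 1 \<Longrightarrow> ring_node n i p \<in> {1..n}"
  by (auto simp: ring_node_def Suc_le_eq)

lemma ring_node_0: "i \<in> {1..n} \<Longrightarrow> ring_node n i 0 = i"
  by (auto simp: ring_node_def)

lemma ring_node_add:
  assumes "i \<in> {1..n}"
  shows "ring_node n (ring_node n i d) p = ring_node n i (d + p)"
proof -
  have "i + (d + p) - 1 = (i + d - 1) + p"
    using assms by auto
  then show ?thesis
    by (simp add: ring_node_def mod_add_left_eq)
qed

lemma ring_node_Suc:
  assumes "i \<in> {1..n}"
  shows "ring_node n i (Suc p) = ring_node n i p mod n + 1"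
  using ring_node_add[OF assms, of p 1] by (simp add: ring_node_def)

lemma ring_node_mod:
  assumes "i \<in> {1..n}"
  shows "ring_node n i (p mod n) = ring_node n i p"
proof -
  have "i + p mod n - 1 = (i - 1) + p mod n" "i + p - 1 = (i - 1) + p"
    using assms by auto
  then show ?thesis
    by (simp add: ring_node_def mod_add_right_eq)
qed

lemma ring_node_self: "i \<in> {1..n} \<Longrightarrow> ring_node n i n = i"
  using ring_node_mod[of i n n] by (simp add: ring_node_0)

lemma ring_offset_less: "n \<ge> 1 \<Longrightarrow> ring_offset n i v < n"
  by (simp add: ring_offset_def)

lemma ring_offset_node:
  assumes "i \<in> {1..n}" "p < n"
  shows "ring_offset n i (ring_node n i p) = p"
proof -
  have "ring_offset n i (ring_node n i p) = ((i + p - 1) mod n + (n + 1 - i)) mod n"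
    using assms by (simp add: ring_node_def ring_offset_def algebra_simps)
  also have "\<dots> = ((i + p - 1) + (n + 1 - i)) mod n"
    by (simp add: mod_add_left_eq)
  also have "(i + p - 1) + (n + 1 - i) = p + n"
    using assms by auto
  finally show ?thesis
    using assms by simp
qed

lemma ring_node_offset:
  assumes "i \<in> {1..n}" "v \<in> {1..n}"
  shows "ring_node n i (ring_offset n i v) = v"
proof -
  have "i + (v + n - i) - 1 = (v - 1) + n"
    using assms by auto
  then have "ring_node n i (v + n - i) = (v - 1 + n) mod n + 1"
    by (simp only: ring_node_def)
  also have "\<dots> = v"
    using assms unfolding mod_add_self2 by auto
  finally have "ring_node n i (v + n - i) = v" .
  then show ?thesis
    by (simp add: ring_offset_def ring_node_mod[OF assms(1)])
qed

lemma ring_node_eq_iff: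
  assumes "i \<in> {1..n}" "p < n" "q < n"
  shows "ring_node n i p = ring_node n i q \<longleftrightarrow> p = q"
  using ring_offset_node[OF assms(1)] assms by metis

lemma ring_offset_eq_0_iff:
  assumes "i \<in> {1..n}" "v \<in> {1..n}"
  shows "ring_offset n i v = 0 \<longleftrightarrow> v = i"
  using ring_node_offset[OF assms] ring_offset_node[of i n 0] ring_node_0[OF assms(1)] assms by auto

text \<open>\<open>d' = n\<close> stands for the return to \<open>i\<close>. The bound
  \<open>d' - d < n\<close> excludes the full turn, whose reduced offset is
  \<open>0\<close>.\<close>

lemma ring_offset_nodes:
  assumes "i \<in> {1..n}" "d < d'" "d' \<le> n" "d' - d < n"
  shows "ring_offset n (ring_node n i d) (ring_node n i d') = d' - d"
  using ring_offset_node[of "ring_node n i d" n "d' - d"] ring_node_add[OF assms(1), of d "d' - d"]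
    ring_node_in[of n i d] assms by simp

lemma ring_edge_node_iff:
  assumes "i \<in> {1..n}" "p < n" "q < n"
  shows "ring_edge n (ring_node n i p) (ring_node n i q) \<longleftrightarrow> q = Suc p mod n \<or> p = Suc q mod n"
proof -
  have *: "a = ring_node n i p mod n + 1 \<longleftrightarrow> a = ring_node n i (Suc p mod n)" for a p
    using assms by (simp add: ring_node_Suc ring_node_mod)
  show ?thesis
    unfolding ring_edge_def * using assms ring_node_in[of n i] by (simp add: ring_node_eq_iff)
qed

section \<open>Rows of the Laplacian along the cut ring\<close>

text \<open>Common reference for the matrix, indexed from \<open>0\<close>, and the table of the
  program, indexed from \<open>1\<close>. Here \<open>c\<close> holds conductances.\<close>

definition laplacian_entry :: "nat \<Rightarrow> (nat \<Rightarrow> nat \<Rightarrow> real) \<Rightarrow> nat \<Rightarrow> nat \<Rightarrow> real" where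
  "laplacian_entry n c i j =
     (if i = j then (\<Sum>l | ring_edge n i l. c i l) else if ring_edge n i j then - c i j else 0)"

lemma laplacian_eq:
  "laplacian n \<nu> = mat n n (\<lambda>(a, b). laplacian_entry n (\<lambda>i j. 1 / \<nu> i j) (Suc a) (Suc b))"
  by (rule eq_matI) (auto simp: laplacian_def laplacian_entry_def Let_def)

lemma laplacian_entry_node:
  assumes n: "n \<ge> 3" and i: "i \<in> {1..n}" and p: "0 < p" "p < n" and q: "q < n"
    and sym: "\<And>i j. ring_edge n i j \<Longrightarrow> c i j = c j i"
  defines "x \<equiv> \<lambda>p. c (ring_node n i p) (ring_node n i (Suc p))"
  shows "laplacian_entry n c (ring_node n i p) (ring_node n i q) =
    (if q = p then x (p - 1) + x p else if q = p - 1 then - x (p - 1)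
     else if q = Suc p mod n then - x p else 0)"
proof -
  have prev: "p = Suc q mod n \<longleftrightarrow> q = p - 1" if "q < n" for q
    using p that by (cases "Suc q = n") auto
  \<comment> \<open>This is where \<open>n \<ge> 3\<close> enters: on two nodes the two neighbours
    would coincide.\<close>
  have neq: "p - 1 \<noteq> Suc p mod n" "p \<noteq> Suc p mod n"
    using p n by (cases "Suc p = n"; auto)+
  have x: "c (ring_node n i p) (ring_node n i (p - 1)) = x (p - 1)"
    unfolding x_def using p i by (subst sym) (auto simp: ring_edge_node_iff)
  have x': "c (ring_node n i p) (ring_node n i (Suc p mod n)) = x p"
    using i by (simp add: x_def ring_node_mod)
  have edge: "ring_edge n (ring_node n i p) l \<longleftrightarrow>
      l \<in> {ring_node n i (p - 1), ring_node n i (Suc p mod n)}" for l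
  proof (cases "l \<in> {1..n}")
    case True
    then obtain q where "q < n" "l = ring_node n i q"
      using ring_node_offset[OF i True] ring_offset_less[of n i l] n by auto
    moreover have "p - 1 < n" "Suc p mod n < n"
      using p by auto
    ultimately show ?thesis
      using p i by (auto simp: ring_edge_node_iff prev ring_node_eq_iff)
  next
    case False
    then show ?thesis
      using ring_node_in[of n i] n by (auto simp: ring_edge_def)
  qed
  have "ring_node n i (p - 1) \<noteq> ring_node n i (Suc p mod n)"
    using neq p i by (simp add: ring_node_eq_iff)
  moreover have "{l. ring_edge n (ring_node n i p) l} = {ring_node n i (p - 1), ring_node n i (Suc p mod n)}"
    using edge by blast
  ultimately have "(\<Sum>l | ring_edge n (ring_node n i p) l. c (ring_node n i p) l) = x (p - 1) + x p"
    using x x' by simp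
  then show ?thesis
    using i p q neq x x' by (auto simp: laplacian_entry_def ring_node_eq_iff ring_edge_node_iff prev)
qed


section \<open>The Green function of an interval\<close>

text \<open>The potential at \<open>p\<close> when unit current enters at \<open>q\<close> and
  \<open>a\<close>, \<open>b\<close> are grounded. It is zero outside the interval, because grounded
  leaders isolate the arcs from each other.\<close>

definition arc_green :: "(nat \<Rightarrow> real) \<Rightarrow> nat \<Rightarrow> nat \<Rightarrow> nat \<Rightarrow> nat \<Rightarrow> real" where
  "arc_green R a b p q =
     (if a \<le> p \<and> p \<le> b then (R (min p q) - R a) * (R b - R (max p q)) / (R b - R a) else 0)"

text \<open>Ohm's law: up to sign, the slope in the coordinate \<open>R\<close> is the current
  through the edge, so it is constant on either side of the pole \<open>q\<close>.\<close>

lemma arc_green_slope: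
  assumes R: "strict_mono R" and q: "a < q" "q < b"
  shows "(arc_green R a b (Suc p) q - arc_green R a b p q) / (R (Suc p) - R p) =
    (if a \<le> p \<and> p < q then (R b - R q) / (R b - R a)
     else if q \<le> p \<and> p < b then - (R q - R a) / (R b - R a) else 0)"
proof -
  have pos: "R (Suc p) - R p > 0" "R b - R a > 0"
    using strict_monoD[OF R] q by simp_all
  \<comment> \<open>The edges just outside the interval, \<open>Suc p = a\<close> and
    \<open>p = b\<close>, are separate cases: there the slope vanishes because the boundary value at
    the end agrees with the default \<open>0\<close>.\<close>
  consider "Suc p < a" | "Suc p = a" | "a \<le> p" "p < q" | "q \<le> p" "p < b" | "p = b" | "b < p"
    using q by linarith
  then show ?thesis
  proof cases
    case 3
    then have "arc_green R a b (Suc p) q - arc_green R a b p q =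
        ((R (Suc p) - R a) * (R b - R q) - (R p - R a) * (R b - R q)) / (R b - R a)"
      using q by (simp add: arc_green_def min_def max_def diff_divide_distrib)
    also have "(R (Suc p) - R a) * (R b - R q) - (R p - R a) * (R b - R q) =
        (R (Suc p) - R p) * (R b - R q)"
      by (simp add: algebra_simps)
    finally show ?thesis using 3 pos by simp
  next
    case 4
    then have "arc_green R a b (Suc p) q - arc_green R a b p q =
        ((R q - R a) * (R b - R (Suc p)) - (R q - R a) * (R b - R p)) / (R b - R a)"
      using q by (simp add: arc_green_def min_def max_def diff_divide_distrib)
    also have "(R q - R a) * (R b - R (Suc p)) - (R q - R a) * (R b - R p) =
        (R (Suc p) - R p) * - (R q - R a)"
      by (simp add: algebra_simps)
    finally show ?thesis using 4 pos by simp
  qed (use q in \<open>auto simp: arc_green_def\<close>)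
qed

text \<open>Kirchhoff's law: the left side is the drop of the slope at \<open>p\<close>. Away from
  the grounded ends the slope drops only at the pole, and there by the whole injected unit of
  current.\<close>

lemma arc_green_harmonic:
  assumes R: "strict_mono R" and q: "a < q" "q < b" and p: "0 < p" "p \<noteq> a" "p \<noteq> b"
  defines "x \<equiv> \<lambda>p. 1 / (R (Suc p) - R p)"
  shows "(x (p - 1) + x p) * arc_green R a b p q - x (p - 1) * arc_green R a b (p - 1) q
    - x p * arc_green R a b (Suc p) q = (if p = q then 1 else 0)"
proof -
  have "R b - R a > 0"
    using strict_monoD[OF R] q by simp
  then have 1: "(R b - R q) / (R b - R a) - - (R q - R a) / (R b - R a) = 1"
    by (simp flip: diff_divide_distrib)
  have key: "(if a \<le> p - 1 \<and> p - 1 < q then u else if q \<le> p - 1 \<and> p - 1 < b then v else 0)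
      - (if a \<le> p \<and> p < q then u else if q \<le> p \<and> p < b then v else 0)
      = (if p = q then u - v else 0)" for u v :: real
    using p q by (cases p q rule: linorder_cases) auto
  have "(x (p - 1) + x p) * arc_green R a b p q - x (p - 1) * arc_green R a b (p - 1) q
      - x p * arc_green R a b (Suc p) q =
      (arc_green R a b (Suc (p - 1)) q - arc_green R a b (p - 1) q) / (R (Suc (p - 1)) - R (p - 1))
      - (arc_green R a b (Suc p) q - arc_green R a b p q) / (R (Suc p) - R p)"
    using p by (simp add: x_def diff_divide_distrib add_divide_distrib algebra_simps)
  also have "\<dots> = (if p = q then 1 else 0)"
    unfolding arc_green_slope[OF R q] key 1 ..
  finally show ?thesis .
qed

section \<open>Sums over the gaps between leaders\<close>

text \<open>The diagonal of \<open>arc_green\<close> summed over the interior, hence the trace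
  contributed by one arc.\<close>

definition arc_cost :: "(nat \<Rightarrow> real) \<Rightarrow> nat \<Rightarrow> nat \<Rightarrow> real" where
  "arc_cost R a b = (\<Sum>q\<in>{a<..<b}. (R q - R a) * (R b - R q) / (R b - R a))"

fun path_weight :: "('v \<Rightarrow> 'v \<Rightarrow> real) \<Rightarrow> 'v list \<Rightarrow> real" where
  "path_weight W (a # b # xs) = W a b + path_weight W (b # xs)"
| "path_weight W _ = 0"

text \<open>The gaps between consecutive entries are disjoint and exhaust the rest of the interval.
  Only consecutive entries constrain \<open>W\<close>, since the intended \<open>e\<close> is the
  resistance to the nearest leaders and matches the arc cost of no larger interval.\<close>

lemma path_weight_eq_sum:
  fixes e :: "nat \<Rightarrow> real"
  assumes "sorted_wrt (<) ds" "ds \<noteq> []"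
    and "successively (\<lambda>a b. W a b = (\<Sum>q\<in>{a<..<b}. e q)) ds"
  shows "path_weight W ds = (\<Sum>q\<in>{hd ds..<last ds} - set ds. e q)"
  using assms
proof (induction W ds rule: path_weight.induct)
  case (1 W a b xs)
  have "last (b # xs) \<in> set (b # xs)"
    by (rule last_in_set) simp
  then have "b \<le> last (b # xs)" "a < b"
    using 1(2) by (auto simp del: last.simps)
  then have "{hd (a # b # xs)..<last (a # b # xs)} - set (a # b # xs) =
      {a<..<b} \<union> ({hd (b # xs)..<last (b # xs)} - set (b # xs))"
    using 1(2) by force
  moreover have "{a<..<b} \<inter> ({hd (b # xs)..<last (b # xs)} - set (b # xs)) = {}"
    by auto
  ultimately show ?case
    using 1 by (simp add: sum.union_disjoint)
qed auto

lemma sorted_wrt_less_successively: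
  fixes ds :: "nat list"
  assumes "sorted_wrt (<) ds"
  shows "successively (\<lambda>a b. a < b \<and> a \<in> set ds \<and> b \<in> set ds \<and> {a<..<b} \<inter> set ds = {}) ds"
  unfolding successively_conv_nth
proof (intro allI impI conjI)
  fix j assume j: "Suc j < length ds"
  then show "ds ! j < ds ! Suc j"
    using assms by (simp add: sorted_wrt_iff_nth_less)
  have "ds ! k \<le> ds ! j \<or> ds ! Suc j \<le> ds ! k" if "k < length ds" for k
    using sorted_wrt_nth_less[OF assms, of k j] sorted_wrt_nth_less[OF assms, of "Suc j" k] that j
    by (cases k j rule: linorder_cases; cases "k = Suc j") auto
  then show "{ds ! j<..<ds ! Suc j} \<inter> set ds = {}"
    by (force simp: in_set_conv_nth)
qed auto

text \<open>Lets a follower \<open>q\<close> alone name the gap it lies in, so that the Green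
  functions of all gaps form one matrix.\<close>

lemma Max_Min_gap:
  fixes D :: "nat set"
  assumes "finite D" "a \<in> D" "b \<in> D" "{a<..<b} \<inter> D = {}" "a < q" "q < b"
  shows "Max {d \<in> D. d \<le> q} = a" "Min {d \<in> D. q < d} = b"
proof -
  show "Max {d \<in> D. d \<le> q} = a"
  proof (rule Max_eqI)
    fix d assume "d \<in> {d \<in> D. d \<le> q}"
    then show "d \<le> a" using assms by (metis (no_types, lifting) IntI disjoint_iff empty_iff
          greaterThanLessThan_iff le_less_trans mem_Collect_eq not_le)
  qed (use assms in auto)
  show "Min {d \<in> D. q < d} = b"
  proof (rule Min_eqI)
    fix d assume "d \<in> {d \<in> D. q < d}"
    then show "b \<le> d" using assms by (metis (no_types, lifting) IntI empty_iff
          greaterThanLessThan_iff less_trans mem_Collect_eq not_le)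
  qed (use assms in auto)
qed

section \<open>Variance of a leader set as a path weight\<close>

text \<open>Deliberately not periodic: the value at \<open>n\<close> is the resistance of the whole
  ring and serves as the coordinate of the second copy of \<open>i\<close>.\<close>

definition ring_resistance :: "nat \<Rightarrow> (nat \<Rightarrow> nat \<Rightarrow> real) \<Rightarrow> nat \<Rightarrow> nat \<Rightarrow> real" where
  "ring_resistance n \<nu> i p = (\<Sum>j<p. \<nu> (ring_node n i j) (ring_node n i (Suc j)))"

lemma ring_edge_Suc:
  assumes "i \<in> {1..n}"
  shows "ring_edge n (ring_node n i p) (ring_node n i (Suc p))"
  unfolding ring_edge_def using assms ring_node_in[of n i p] ring_node_in[of n i "Suc p"]
  by (auto simp: ring_node_Suc)

lemma ring_resistance_strict_mono:
  assumes "ring_network n \<nu>" "i \<in> {1..n}"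
  shows "strict_mono (ring_resistance n \<nu> i)"
  using assms ring_edge_Suc[OF assms(2)]
  by (auto simp: strict_mono_Suc_iff ring_resistance_def ring_network_def)

lemma ring_resistance_Suc:
  "ring_resistance n \<nu> i (Suc p) - ring_resistance n \<nu> i p = \<nu> (ring_node n i p) (ring_node n i (Suc p))"
  by (simp add: ring_resistance_def)

lemma ring_resistance_add:
  assumes "i \<in> {1..n}"
  shows "ring_resistance n \<nu> (ring_node n i d) p = ring_resistance n \<nu> i (d + p) - ring_resistance n \<nu> i d"
  by (induction p) (simp_all add: ring_resistance_def ring_node_add[OF assms])

text \<open>Row \<open>p\<close> of the grounded Laplacian meets column \<open>q\<close> of the
  candidate inverse. As the potential vanishes at leaders, the deleted columns can be restored, and
  the row sum becomes Kirchhoff's law at \<open>p\<close>.\<close>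

lemma laplacian_green:
  assumes net: "ring_network n \<nu>" and i: "i \<in> {1..n}"
    and D: "0 \<in> D" "n \<in> D" "D \<subseteq> {0..n}" and ab: "a \<in> D" "b \<in> D" "{a<..<b} \<inter> D = {}"
    and q: "a < q" "q < b" and p: "p < n" "p \<notin> D"
  defines "G \<equiv> \<lambda>p. arc_green (ring_resistance n \<nu> i) a b p q"
  shows "(\<Sum>r | r < n \<and> r \<notin> D. laplacian_entry n (\<lambda>i j. 1 / \<nu> i j) (ring_node n i p) (ring_node n i r) * G r) =
    (if p = q then 1 else 0)" (is "(\<Sum>r | _. ?l r * G r) = _")
proof -
  define R where "R = ring_resistance n \<nu> i"
  define x where "x = (\<lambda>p. 1 / (R (Suc p) - R p))"
  have R: "strict_mono R"
    unfolding R_def by (rule ring_resistance_strict_mono[OF net i])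
  have n: "n \<ge> 3" and sym: "ring_edge n i j \<Longrightarrow> 1 / \<nu> i j = 1 / \<nu> j i" for i j
    using net by (auto simp: ring_network_def)
  have p0: "0 < p" "p \<noteq> a" "p \<noteq> b"
    using p D ab by (auto intro: gr0I)
  have G0: "G r = 0" if "r \<in> D" for r
  proof -
    have "r \<notin> {a<..<b}"
      using that ab by blast
    then have "r \<le> a \<or> b \<le> r"
      by auto
    then show ?thesis
      using q by (auto simp: G_def arc_green_def min_def max_def)
  qed
  have l: "?l r = (if r = p then x (p - 1) + x p else if r = p - 1 then - x (p - 1)
      else if r = Suc p mod n then - x p else 0)" if "r < n" for r
    by (simp add: laplacian_entry_node[OF n i p0(1) p(1) that sym] x_def R_def ring_resistance_Suc
        del: One_nat_def)
  have neq: "p - 1 \<noteq> Suc p mod n" "p \<noteq> Suc p mod n" "p - 1 \<noteq> p"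
    using p0 p n by (cases "Suc p = n"; auto)+
  \<comment> \<open>The matrix sends the successor of \<open>n - 1\<close> to offset
    \<open>0\<close>, the coordinate sends it to \<open>n\<close>; both are grounded, so the
    potential is the same.\<close>
  have wrap: "G (Suc p mod n) = G (Suc p)"
    using p D G0[of 0] G0[of n] by (cases "Suc p = n") auto
  have "(\<Sum>r | r < n \<and> r \<notin> D. ?l r * G r) = (\<Sum>r<n. ?l r * G r)"
    by (rule sum.mono_neutral_left) (auto simp: G0)
  also have "\<dots> = (\<Sum>r\<in>{p, p - 1, Suc p mod n}. ?l r * G r)"
    using p by (intro sum.mono_neutral_right) (auto simp: l)
  also have "\<dots> = (x (p - 1) + x p) * G p - x (p - 1) * G (p - 1) - x p * G (Suc p)"
    using p neq wrap by (simp add: l del: One_nat_def)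
  also have "\<dots> = (if p = q then 1 else 0)"
    unfolding G_def R_def[symmetric] x_def by (rule arc_green_harmonic[OF R q p0])
  finally show ?thesis .
qed

lemma gap_around:
  fixes D :: "nat set"
  assumes "finite D" "0 \<in> D" "n \<in> D" "q < n" "q \<notin> D"
  defines "a \<equiv> Max {d \<in> D. d \<le> q}" and "b \<equiv> Min {d \<in> D. q < d}"
  shows "a \<in> D" "b \<in> D" "{a<..<b} \<inter> D = {}" "a < q" "q < b"
proof -
  have 1: "a \<in> {d \<in> D. d \<le> q}"
    unfolding a_def using assms(1-5) by (intro Max_in) auto
  then show "a \<in> D" by simp
  show "a < q"
    using 1 assms(5) by (metis (no_types, lifting) le_neq_implies_less mem_Collect_eq)
  have 2: "b \<in> {d \<in> D. q < d}"
    unfolding b_def using assms(1-5) by (intro Min_in) auto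
  then show "b \<in> D" "q < b" by auto
  show "{a<..<b} \<inter> D = {}"
  proof (rule ccontr)
    assume "{a<..<b} \<inter> D \<noteq> {}"
    then obtain d where d: "a < d" "d < b" "d \<in> D"
      by auto
    show False
    proof (cases "d \<le> q")
      case True
      then have "d \<le> a"
        unfolding a_def using assms(1) d by (intro Max_ge) auto
      with d show False by simp
    next
      case False
      then have "b \<le> d"
        unfolding b_def using assms(1) d by (intro Min_le) auto
      with d show False by simp
    qed
  qed
qed

text \<open>The leader \<open>i\<close> occurs twice in \<open>ds\<close>, at both ends of the cut
  ring. The candidate inverse has one block per gap, and its diagonal adds up to the arc
  costs.\<close>

lemma total_variance_eq_path_weight:
  assumes net: "ring_network n \<nu>" and i: "i \<in> {1..n}"
    and ds: "sorted_wrt (<) ds" "ds \<noteq> []" "hd ds = 0" "last ds = n"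
  shows "total_variance n \<nu> (ring_node n i ` set ds) =
    1 / 2 * path_weight (arc_cost (ring_resistance n \<nu> i)) ds"
proof -
  define D where "D = set ds"
  define R where "R = ring_resistance n \<nu> i"
  define S where "S = ring_node n i ` set ds"
  define off where "off = (\<lambda>a. ring_offset n i (Suc a))"
  define I where "I = {a. Suc a \<notin> S}"
  define lo where "lo = (\<lambda>q. Max {d \<in> D. d \<le> q})"
  define hi where "hi = (\<lambda>q. Min {d \<in> D. q < d})"
  \<comment> \<open>The gap is chosen by the column \<open>q\<close>; for a follower
    \<open>p\<close> in another gap the entry is \<open>0\<close>.\<close>
  define G where "G = (\<lambda>p q. arc_green R (lo q) (hi q) p q)"
  define l where "l = (\<lambda>a b. laplacian_entry n (\<lambda>i j. 1 / \<nu> i j) (Suc a) (Suc b))"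
  have n: "n \<ge> 3"
    using net by (simp add: ring_network_def)
  have le: "d \<le> n" if "d \<in> D" for d
  proof -
    obtain k where k: "k < length ds" "d = ds ! k"
      using \<open>d \<in> D\<close> by (auto simp: D_def in_set_conv_nth)
    show "d \<le> n"
    proof (cases "k = length ds - 1")
      case True
      then show ?thesis using k ds by (simp add: last_conv_nth)
    next
      case False
      then have "ds ! k < ds ! (length ds - 1)"
        using k by (intro sorted_wrt_nth_less[OF ds(1)]) auto
      then show ?thesis using k ds by (simp add: last_conv_nth)
    qed
  qed
  have D: "finite D" "0 \<in> D" "n \<in> D" "D \<subseteq> {0..n}"
    using ds hd_in_set[OF ds(2)] last_in_set[OF ds(2)] le by (auto simp: D_def)
  note gap = gap_around[OF D(1-3), folded lo_def hi_def]
  have node: "ring_node n i (off a) = Suc a" "off a < n" if "a < n" for a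
    using that i ring_node_offset[of i n "Suc a"] ring_offset_less[of n i] by (auto simp: off_def)
  have I: "a \<in> I \<longleftrightarrow> off a \<notin> D" if "a < n" for a
  proof -
    have "Suc a \<in> S \<longleftrightarrow> off a \<in> D"
    proof
      assume "Suc a \<in> S"
      then obtain d where d: "d \<in> D" "Suc a = ring_node n i d"
        by (auto simp: S_def D_def)
      show "off a \<in> D"
      proof (cases "d < n")
        case True
        then show ?thesis
          using d i by (simp add: off_def ring_offset_node)
      next
        \<comment> \<open>Only \<open>d = n\<close> is left. It names \<open>i\<close> again, whose
          reduced offset \<open>0\<close> lies in \<open>D\<close> too.\<close>
        case False
        then have "Suc a = i"
          using le[OF d(1)] d i by (simp add: ring_node_self)
        then have "off a = 0"
          using i unfolding off_def by (simp add: ring_offset_def)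
        then show ?thesis
          using D by simp
      qed
    next
      assume "off a \<in> D"
      then show "Suc a \<in> S"
        unfolding S_def D_def[symmetric] using node(1)[OF that] by (metis image_eqI)
    qed
    then show ?thesis by (simp add: I_def)
  qed
  have bij: "bij_betw off {a. a < n \<and> a \<in> I} {p. p < n \<and> p \<notin> D}"
  proof (rule bij_betwI[where g = "\<lambda>p. ring_node n i p - 1"])
    show "off \<in> {a. a < n \<and> a \<in> I} \<rightarrow> {p. p < n \<and> p \<notin> D}"
      using node I by auto
    have off: "off (ring_node n i p - 1) = p" if "p < n" for p
      using that i ring_node_in[of n i p] by (simp add: off_def ring_offset_node)
    then show "(\<lambda>p. ring_node n i p - 1) \<in> {p. p < n \<and> p \<notin> D} \<rightarrow> {a. a < n \<and> a \<in> I}"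
      using I ring_node_in[of n i] n by (auto simp: ring_node_def)
    show "off (ring_node n i p - 1) = p" if "p \<in> {p. p < n \<and> p \<notin> D}" for p
      using that off by simp
  qed (use node in simp)
  have inv: "(\<Sum>c | c < n \<and> c \<in> I. l a c * G (off c) (off b)) = (if a = b then 1 else 0)"
    if a: "a < n" "a \<in> I" and b: "b < n" "b \<in> I" for a b
  proof -
    have "(\<Sum>c | c < n \<and> c \<in> I. l a c * G (off c) (off b)) =
        (\<Sum>c | c < n \<and> c \<in> I. laplacian_entry n (\<lambda>i j. 1 / \<nu> i j)
          (ring_node n i (off a)) (ring_node n i (off c)) * G (off c) (off b))"
      using a by (intro sum.cong) (auto simp: l_def node)
    also have "\<dots> = (\<Sum>r | r < n \<and> r \<notin> D. laplacian_entry n (\<lambda>i j. 1 / \<nu> i j)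
          (ring_node n i (off a)) (ring_node n i r) * G r (off b))"
      by (rule sum.reindex_bij_betw[OF bij])
    also have "\<dots> = (if off a = off b then 1 else 0)"
      unfolding G_def R_def using a b I node gap[of "off b"]
      by (intro laplacian_green[OF net i D(2-4)]) (simp_all add: lo_def hi_def)
    also have "off a = off b \<longleftrightarrow> a = b"
      using node(1)[OF a(1)] node(1)[OF b(1)] by (metis Suc_inject)
    finally show ?thesis .
  qed
  have "trace (the (mat_inverse (laplacian_ff n \<nu> S))) = (\<Sum>a | a < n \<and> a \<in> I. G (off a) (off a))"
    unfolding laplacian_ff_def laplacian_eq I_def[symmetric]
    using trace_mat_inverse_submatrix[of n I l "\<lambda>a b. G (off a) (off b)"] inv by (simp add: l_def)
  also have "\<dots> = (\<Sum>p | p < n \<and> p \<notin> D. G p p)"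
    by (rule sum.reindex_bij_betw[OF bij])
  also have "\<dots> = (\<Sum>p\<in>{hd ds..<last ds} - set ds. G p p)"
    by (rule sum.cong) (auto simp: ds D_def)
  also have "\<dots> = path_weight (arc_cost R) ds"
  proof (rule path_weight_eq_sum[symmetric, OF ds(1,2)])
    show "successively (\<lambda>a b. arc_cost R a b = (\<Sum>q\<in>{a<..<b}. G q q)) ds"
    proof (rule successively_mono[OF sorted_wrt_less_successively[OF ds(1)]])
      fix a b
      assume ab: "a < b \<and> a \<in> set ds \<and> b \<in> set ds \<and> {a<..<b} \<inter> set ds = {}"
      then have "lo q = a" "hi q = b" if "q \<in> {a<..<b}" for q
        using Max_Min_gap[OF D(1), of a b q] that by (auto simp: lo_def hi_def D_def)
      then show "arc_cost R a b = (\<Sum>q\<in>{a<..<b}. G q q)"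
        unfolding arc_cost_def G_def by (intro sum.cong) (auto simp: arc_green_def)
    qed
  qed
  finally show ?thesis
    by (simp add: total_variance_def S_def R_def)
qed


section \<open>The weight table and the ring digraphs\<close>

lemma upd2_apply: "upd2 A i j x i' j' = (if i' = i \<and> j' = j then x else A i' j')"
  by (simp add: upd2_def)

lemma atLeastLessThan_plus_1: "{1..<n + 1} = {1..n::nat}"
  by auto

text \<open>An inner iteration takes at most 11 operations, namely seven for the edge test and four
  to store an entry; the other bounds are counted likewise.\<close>

lemma laplacian_table_spec:
  "spec (laplacian_table n c) (n * (n * 12 + 3) + 1)
    (\<lambda>L. \<forall>i\<in>{1..n}. \<forall>j\<in>{1..n}. L i j = laplacian_entry n c i j)"
  unfolding laplacian_table_def
  apply (rule specI)
  apply (rule wp_foreach_upt[where B = "n * 12 + 2" and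
        I = "\<lambda>i L. \<forall>i'\<in>{1..<i}. \<forall>j\<in>{1..n}. L i' j = laplacian_entry n c i' j"])
     apply simp
    apply simp
  subgoal premises outer for i L
    apply (simp only: wp_bind)
    \<comment> \<open>The row invariant treats the diagonal like any other position; that cell is
      overwritten with the row sum after the inner loop.\<close>
    apply (rule wp_foreach_upt[where B = 11 and
          I = "\<lambda>j (L, \<Delta>). (\<forall>i'\<in>{1..<i}. \<forall>j\<in>{1..n}. L i' j = laplacian_entry n c i' j) \<and>
            (\<forall>j'\<in>{1..<j}. L i j' = (if ring_edge n i j' then - c i j' else 0)) \<and>
            \<Delta> = (\<Sum>l | l \<in> {1..<j} \<and> ring_edge n i l. c i l)"])
    subgoal using outer by simp
    subgoal by simp
    subgoal premises inner for j S
    proof -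
      have edge: "(j = Suc (i mod n) \<or> i = Suc (j mod n)) = ring_edge n i j"
        using outer inner by (auto simp: ring_edge_def)
      moreover have "{l \<in> {1..<Suc j}. ring_edge n i l} =
          (if ring_edge n i j then insert j {l \<in> {1..<j}. ring_edge n i l}
           else {l \<in> {1..<j}. ring_edge n i l})"
        using inner by (auto simp: less_Suc_eq)
      ultimately show ?thesis
        using outer inner
        by (cases S; cases "ring_edge n i j") (simp_all add: upd2_apply atLeastLessThanSuc)
    qed
    subgoal premises inner for S t
    proof -
      have "{l \<in> {1..n}. ring_edge n i l} = {l. ring_edge n i l}"
        by (auto simp: ring_edge_def)
      then show ?thesis
        using outer inner unfolding atLeastLessThan_plus_1
        by (cases S) (auto simp: upd2_apply atLeastLessThanSuc laplacian_entry_def)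
    qed
    done
  subgoal by (simp add: algebra_simps)
  done

lemma shifted_table_spec:
  "spec (shifted_table n L u) (n * (n * 11 + 2) + 1)
    (\<lambda>M. \<forall>p\<in>{1..n}. \<forall>q\<in>{1..n}. M p q = L (ring_node n u (p - 1)) (ring_node n u (q - 1)))"
  unfolding shifted_table_def
  apply (rule specI)
  apply (rule wp_foreach_upt[where B = "n * 11 + 1" and I = "\<lambda>p M. \<forall>p'\<in>{1..<p}. \<forall>q\<in>{1..n}.
        M p' q = L (ring_node n u (p' - 1)) (ring_node n u (q - 1))"])
     apply simp
    apply simp
  subgoal premises outer for p M
    apply (rule wp_foreach_upt[where B = 10 and I = "\<lambda>q M.
        (\<forall>p'\<in>{1..<p}. \<forall>q\<in>{1..n}. M p' q = L (ring_node n u (p' - 1)) (ring_node n u (q - 1))) \<and>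
        (\<forall>q'\<in>{1..<q}. M p q' = L (ring_node n u (p - 1)) (ring_node n u (q' - 1)))"])
    subgoal using outer by simp
    subgoal by simp
    subgoal premises inner for q M
    proof -
      have "(u + r - 2) mod n + 1 = ring_node n u (r - 1)" if "1 \<le> r" for r
        using that by (simp add: ring_node_def numeral_2_eq_2)
      then show ?thesis
        using outer inner by (simp add: shifted_index_def upd2_apply atLeastLessThanSuc del: One_nat_def)
    qed
    subgoal using outer unfolding atLeastLessThan_plus_1 by (simp add: atLeastLessThanSuc)
    done
  subgoal by (simp add: algebra_simps)
  done

text \<open>Eliminating a node tied to the leader by \<open>x\<close> and to the next node by
  \<open>y\<close> leaves both resistors in series. Signs and grouping copy the expression evaluated
  by \<open>pivot\<close>.\<close>

lemma pivot_recurrence: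
  fixes x y :: real
  assumes "x > 0" "y > 0"
  shows "1 / y + z - - (1 / y) * - (1 / y) / (1 / y + 1 / x) = z + 1 / (x + y)"
proof -
  have "1 / y - (1 / y) * (1 / y) / (1 / y + 1 / x) = 1 / (x + y)"
  proof -
    have "1 / y + 1 / x = (x + y) / (x * y)"
      using assms by (simp add: field_simps)
    then have "(1 / y) * (1 / y) / (1 / y + 1 / x) = x / (y * (x + y))"
      using assms by simp
    moreover have "1 / y - x / (y * (x + y)) = 1 / (x + y)"
      using assms by (simp add: divide_simps)
    ultimately show ?thesis by simp
  qed
  then show ?thesis by simp
qed

text \<open>For the grounded Laplacian of a path with resistances \<open>R (p + 1) - R p\<close> the pivots are
  \<open>\<delta> p = g p + 1 / (R p - R j)\<close> and \<open>\<epsilon> p = g (p - 1) + 1 / (R l - R p)\<close>: each elimination replaces the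
  eliminated part of the path by a single resistor to the leader at its end.\<close>

lemma tridiagonal_inverse_trace_spec:
  fixes R :: "nat \<Rightarrow> real"
  defines "g \<equiv> \<lambda>p. 1 / (R (Suc p) - R p)"
  assumes R: "strict_mono_on {j..l} R" and jl: "j < l"
    and diag: "\<And>p. j < p \<Longrightarrow> p < l \<Longrightarrow> M p p = g (p - 1) + g p"
    and upper: "\<And>p. j < p \<Longrightarrow> Suc p < l \<Longrightarrow> M p (Suc p) = - g p"
    and lower: "\<And>p. j < p \<Longrightarrow> Suc p < l \<Longrightarrow> M (Suc p) p = - g p"
  shows "spec (tridiagonal_inverse_trace M j l) (30 * l + 5) (\<lambda>x. x = arc_cost R j l)"
proof -
  have less: "R p < R q" if "j \<le> p" "p < q" "q \<le> l" for p q
    using strict_mono_onD[OF R, of p q] that by simp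
  show ?thesis
    unfolding tridiagonal_inverse_trace_def pivot_def
    apply (rule specI)
    apply (simp only: wp_bind wp_step)
    apply (rule wp_foreach_upt[where B = 10 and
          I = "\<lambda>q \<delta>. \<forall>p\<in>{j + 1..<q}. \<delta> p = g p + 1 / (R p - R j)"])
    subgoal by simp
    subgoal using jl by simp
    subgoal premises prems for p \<delta>
    proof (cases "p = j + 1")
      case True
      then show ?thesis
        using prems diag[of p] by (simp add: less_Suc_eq g_def)
    next
      case False
      then obtain q where q: "p = Suc q" "j < q"
        using prems by (cases p) auto
      have "M p p - M p q * M q p / \<delta> q = g p + 1 / (R p - R j)"
        using pivot_recurrence[of "R q - R j" "R p - R q" "g p"] prems q diag[of p] upper[of q]
          lower[of q] less[of j q] less[of q p] by (simp add: g_def)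
      then show ?thesis
        using prems q by (auto simp: less_Suc_eq)
    qed
    subgoal premises fwd for \<delta> t
      apply (rule wp_foreach_rev_upt[where B = 10 and
            I = "\<lambda>q \<epsilon>. \<forall>p\<in>{q..<l}. \<epsilon> p = g (p - 1) + 1 / (R l - R p)"])
      subgoal by simp
      subgoal using jl by simp
      subgoal premises prems for p \<epsilon>
      proof (cases "Suc p = l")
        case True
        then show ?thesis
          using prems diag[of p] by (auto simp: g_def)
      next
        case False
        have "M p p - M p (Suc p) * M (Suc p) p / \<epsilon> (Suc p) = g (p - 1) + 1 / (R l - R p)"
          using pivot_recurrence[of "R l - R (Suc p)" "R (Suc p) - R p" "g (p - 1)"] prems False
            diag[of p] upper[of p] lower[of p] less[of p "Suc p"] less[of "Suc p" l]
          by (simp add: g_def add.commute)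
        moreover have "{p..<l} = insert p {Suc p..<l}"
          using prems by auto
        ultimately show ?thesis
          using prems False by auto
      qed
      subgoal premises bwd for \<epsilon> t'
        apply (rule wp_foreach_upt[where B = 7 and I = "\<lambda>q s. s = (\<Sum>p\<in>{j + 1..<q}. 
            (R p - R j) * (R l - R p) / (R l - R j))"])
        subgoal by simp
        subgoal using jl by simp
        subgoal premises prems for p s
        proof -
          have pos: "R p - R j > 0" "R l - R p > 0"
            using less[of j p] less[of p l] prems by auto
          \<comment> \<open>The conductances of the edges next to \<open>p\<close> cancel against
            \<open>M p p\<close>. What remains is the conductance to each leader, and the reciprocal
            of the sum is their parallel resistance.\<close>
          have "\<delta> p + \<epsilon> p - M p p = 1 / (R p - R j) + 1 / (R l - R p)"
            using fwd bwd prems diag[of p] by simp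
          also have "1 / \<dots> = (R p - R j) * (R l - R p) / (R l - R j)"
            using pos by (simp add: field_simps)
          finally show ?thesis
            using prems by simp
        qed
        subgoal premises prems for s t''
        proof -
          have "{j<..<l} = {j + 1..<l}" by auto
          then show ?thesis
            using prems fwd bwd by (simp add: arc_cost_def)
        qed
        done
      done
    done
qed

lemma arc_cost_shift: "arc_cost R (a + k) (b + k) = arc_cost (\<lambda>p. R (p + k)) a b"
proof -
  have "{a + k<..<b + k} = (\<lambda>p. p + k) ` {a<..<b}"
  proof
    show "{a + k<..<b + k} \<subseteq> (\<lambda>p. p + k) ` {a<..<b}"
    proof
      fix q assume "q \<in> {a + k<..<b + k}"
      then have "q = (q - k) + k" "q - k \<in> {a<..<b}"
        by auto
      then show "q \<in> (\<lambda>p. p + k) ` {a<..<b}"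
        by blast
    qed
  qed auto
  then show ?thesis
    by (simp add: arc_cost_def sum.reindex)
qed

text \<open>A new starting node shifts the coordinate by a constant, and arc costs depend on
  differences only. Hence one weight table serves the digraphs of all \<open>i\<close>.\<close>

lemma arc_cost_ring_node:
  assumes "i \<in> {1..n}" "d \<le> d'"
  shows "arc_cost (ring_resistance n \<nu> (ring_node n i d)) 0 (d' - d) =
    arc_cost (ring_resistance n \<nu> i) d d'"
  using arc_cost_shift[of "ring_resistance n \<nu> i" 0 d "d' - d"] assms
  by (simp add: arc_cost_def ring_resistance_add add.commute)

text \<open>A shifted matrix costs \<open>O(n^2)\<close> for each \<open>u\<close> and a trace
  \<open>O(n)\<close> for each pair, so the table stays cubic.\<close>

lemma weight_table_spec:
  assumes net: "ring_network n \<nu>"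
    and L: "\<forall>i\<in>{1..n}. \<forall>j\<in>{1..n}. L i j = laplacian_entry n (\<lambda>i j. 1 / \<nu> i j) i j"
  shows "spec (weight_table n L) (n * (n * (n * 11 + 2) + n * (30 * n + 12) + 4) + 1)
    (\<lambda>w. \<forall>u\<in>{1..n}. \<forall>v\<in>{1..n}. u \<noteq> v \<longrightarrow>
      w u v = arc_cost (ring_resistance n \<nu> u) 0 (ring_offset n u v))"
proof -
  have n: "n \<ge> 3" and sym: "ring_edge n i j \<Longrightarrow> 1 / \<nu> i j = 1 / \<nu> j i" for i j
    using net by (auto simp: ring_network_def)
  have tri: "spec (tridiagonal_inverse_trace M 1 l) (30 * n + 5)
      (\<lambda>x. x = arc_cost (ring_resistance n \<nu> u) 0 (l - 1))"
    if u: "u \<in> {1..n}" and l: "1 < l" "l \<le> n"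
      and M: "\<forall>p\<in>{1..n}. \<forall>q\<in>{1..n}. M p q = L (ring_node n u (p - 1)) (ring_node n u (q - 1))"
    for u l M
  proof -
    \<comment> \<open>Row \<open>p\<close> of \<open>M\<close> has offset \<open>p - 1\<close>.
      Truncated subtraction makes \<open>R 0 = R 1\<close>, so monotonicity is strict only from
      \<open>1\<close> on.\<close>
    define R where "R = (\<lambda>p. ring_resistance n \<nu> u (p - 1))"
    have R: "strict_mono_on {1..l} R"
      using ring_resistance_strict_mono[OF net u] unfolding R_def strict_mono_def
      by (intro strict_mono_onI) auto
    have M': "M (Suc p) (Suc q) = laplacian_entry n (\<lambda>i j. 1 / \<nu> i j) (ring_node n u p) (ring_node n u q)"
      if "p < n" "q < n" for p q
      using M L that ring_node_in[of n u] n by simp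
    note entry = laplacian_entry_node[OF n u _ _ _ sym]
    have x: "1 / \<nu> (ring_node n u p) (ring_node n u (Suc p)) = 1 / (R (Suc (Suc p)) - R (Suc p))" for p
      by (simp add: R_def ring_resistance_Suc)
    have "spec (tridiagonal_inverse_trace M 1 l) (30 * l + 5) (\<lambda>x. x = arc_cost R 1 l)"
    proof (rule tridiagonal_inverse_trace_spec[OF R l(1)])
      fix p assume p: "1 < p" "p < l"
      then obtain q where q: "p = Suc (Suc q)"
        using that[of "p - 2"] by simp
      show "M p p = 1 / (R (Suc (p - 1)) - R (p - 1)) + 1 / (R (Suc p) - R p)"
        using p l by (simp add: q M' entry x)
    next
      fix p assume p: "1 < p" "Suc p < l"
      then obtain q where q: "p = Suc (Suc q)"
        using that[of "p - 2"] by simp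
      show "M p (Suc p) = - (1 / (R (Suc p) - R p))"
        using p l by (simp add: q M' entry x)
      show "M (Suc p) p = - (1 / (R (Suc p) - R p))"
        using p l by (simp add: q M' entry x)
    qed
    moreover have "arc_cost R 1 l = arc_cost (ring_resistance n \<nu> u) 0 (l - 1)"
      using arc_cost_shift[of R 0 1 "l - 1"] l by (simp add: R_def)
    ultimately show ?thesis
      using l by (auto elim: spec_weaken)
  qed
  show ?thesis
    unfolding weight_table_def
    apply (rule specI)
    apply (rule wp_foreach_upt[where B = "n * (n * 11 + 2) + n * (30 * n + 12) + 3" and
          I = "\<lambda>i w. \<forall>u\<in>{1..<i}. \<forall>v\<in>{1..n}. u \<noteq> v \<longrightarrow>
            w u v = arc_cost (ring_resistance n \<nu> u) 0 (ring_offset n u v)"])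
    subgoal by simp
    subgoal by simp
    subgoal premises outer for u w
      apply (simp only: wp_bind)
      apply (rule wp_spec[OF shifted_table_spec])
      subgoal premises M for M t
        apply (rule wp_foreach_upt[where B = "30 * n + 11" and
              I = "\<lambda>j w. (\<forall>u\<in>{1..<u}. \<forall>v\<in>{1..n}. u \<noteq> v \<longrightarrow>
                w u v = arc_cost (ring_resistance n \<nu> u) 0 (ring_offset n u v)) \<and>
                (\<forall>v\<in>{1..<j}. u \<noteq> v \<longrightarrow>
                w u v = arc_cost (ring_resistance n \<nu> u) 0 (ring_offset n u v))"])
        subgoal using outer by simp
        subgoal by simp
        subgoal premises inner for v w
        proof (cases "u = v")
          case True
          then show ?thesis
            using inner by (simp add: atLeastLessThanSuc)
        next
          case False
          have uv: "u \<in> {1..n}" "v \<in> {1..n}"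
            using outer inner by auto
          then have l: "1 < (v + n - u) mod n + 1" "(v + n - u) mod n + 1 \<le> n"
            using ring_offset_eq_0_iff[OF uv] ring_offset_less[of n u v] n False
            by (auto simp: ring_offset_def Suc_le_eq)
          show ?thesis
            using False inner uv
            by (simp, intro wp_spec[OF tri[OF uv(1) l[unfolded Suc_eq_plus1[symmetric]] M(1), simplified]])
              (auto simp: upd2_apply atLeastLessThanSuc ring_offset_def)
        qed
        subgoal using outer M(2) unfolding atLeastLessThan_plus_1
          by (simp add: atLeastLessThanSuc add_mult_distrib2)
        done
      done
    subgoal by (simp add: algebra_simps)
    done
qed


text \<open>Source and target are the two ends of the ring cut at \<open>i\<close>.\<close>

fun vertex_offset :: "nat \<Rightarrow> nat \<Rightarrow> vertex \<Rightarrow> nat" where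
  "vertex_offset n i Source = 0"
| "vertex_offset n i Target = n"
| "vertex_offset n i (Node v) = ring_offset n i v"

lemma wp_clockwise_offset:
  "wp (clockwise_offset n i u) Q t = Q (ring_offset n i u) (Suc (Suc (Suc t)))"
  by (simp add: clockwise_offset_def ring_offset_def)

text \<open>With source and target at the offsets \<open>0\<close> and \<open>n\<close>, one
  inequality describes all three kinds of edges; only the pair (\<open>Source\<close>,
  \<open>Target\<close>) must be excluded.\<close>

lemma ring_digraph_spec:
  assumes i: "i \<in> {1..n}"
    and w: "\<forall>u\<in>{1..n}. \<forall>v\<in>{1..n}. u \<noteq> v \<longrightarrow>
      w u v = arc_cost (ring_resistance n \<nu> u) 0 (ring_offset n u v)"
  defines "\<phi> \<equiv> vertex_offset n i"
  shows "spec (ring_digraph n w i) (n * 3 + (n + 2) * ((n + 2) * 13 + 2) + 2)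
    (\<lambda>(V, E, W). set V = {Source, Target} \<union> Node ` ({1..n} - {i}) \<and> length V \<le> n + 2 \<and>
      (\<forall>a\<in>set V. \<forall>b\<in>set V. (E a b \<longleftrightarrow> \<phi> a < \<phi> b \<and> (a, b) \<noteq> (Source, Target)) \<and>
        (E a b \<longrightarrow> W a b = arc_cost (ring_resistance n \<nu> i) (\<phi> a) (\<phi> b))))"
proof -
  define U where "U = {Source, Target} \<union> Node ` ({1..n} - {i})"
  have off: "0 < ring_offset n i v" "ring_offset n i v < n" "ring_node n i (ring_offset n i v) = v"
    if "v \<in> {1..n} - {i}" for v
    using that ring_offset_eq_0_iff[of i n v] ring_offset_less[of n i v] ring_node_offset[of i n v] i
    by auto
  have le: "\<not> n < ring_offset n i v" for v
    using ring_offset_less[of n i v] i by auto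
  have weight: "w (ring_node n i d) (ring_node n i d') = arc_cost (ring_resistance n \<nu> i) d d'"
    if "d < d'" "d' \<le> n" "d' - d < n" for d d'
  proof -
    have "ring_offset n (ring_node n i d) (ring_node n i d') = d' - d"
      by (rule ring_offset_nodes[OF i that])
    moreover from this have "ring_node n i d \<noteq> ring_node n i d'"
      using ring_offset_eq_0_iff[of "ring_node n i d" n "ring_node n i d'"] ring_node_in[of n i] i that
      by auto
    ultimately show ?thesis
      using w ring_node_in[of n i] i that arc_cost_ring_node[OF i, of d d' \<nu>] by simp
  qed
  have entry: "spec (edge_entry n w i a b) 9 (\<lambda>(e, x). (e \<longleftrightarrow> \<phi> a < \<phi> b \<and> (a, b) \<noteq> (Source, Target)) \<and>
      (e \<longrightarrow> x = arc_cost (ring_resistance n \<nu> i) (\<phi> a) (\<phi> b)))"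
    if ab: "a \<in> U" "b \<in> U" for a b
  proof -
    have 1: "w i v = arc_cost (ring_resistance n \<nu> i) 0 (ring_offset n i v)"
      if "v \<in> {1..n} - {i}" for v
      using weight[of 0 "ring_offset n i v"] off[OF that] i by (simp add: ring_node_0)
    have 2: "w v i = arc_cost (ring_resistance n \<nu> i) (ring_offset n i v) n"
      if "v \<in> {1..n} - {i}" for v
      using weight[of "ring_offset n i v" n] off[OF that] i by (simp add: ring_node_self)
    have 3: "w u v = arc_cost (ring_resistance n \<nu> i) (ring_offset n i u) (ring_offset n i v)"
      if "u \<in> {1..n} - {i}" "v \<in> {1..n} - {i}" "ring_offset n i u < ring_offset n i v" for u v
      using weight[of "ring_offset n i u" "ring_offset n i v"] off[OF that(1)] off[OF that(2)] that
      by simp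
    show ?thesis
      using ab
      by (cases a; cases b)
        (simp_all add: specI U_def \<phi>_def wp_clockwise_offset image_iff off(1,2) le 1 2 3)
  qed
  show ?thesis
    unfolding ring_digraph_def
    apply (rule specI)
    apply (simp only: wp_bind)
    apply (rule wp_foreach_upt[where B = 2 and I = "\<lambda>j V. set V = {Source, Target} \<union>
          Node ` ({1..<j} - {i}) \<and> length V \<le> j + 1"])
    subgoal by simp
    subgoal by simp
    subgoal by (auto simp: atLeastLessThanSuc)
    subgoal premises V for V t
    proof -
      have VU: "set V = U" "length V \<le> n + 2"
        using V(1) unfolding U_def atLeastLessThan_plus_1 by simp_all
      show ?thesis
        apply (rule wp_foreach_set[where B = "length V * 12 + 1" and
              I = "\<lambda>A (E, W). \<forall>a\<in>A. \<forall>b\<in>set V. (E a b \<longleftrightarrow> \<phi> a < \<phi> b \<and> (a, b) \<noteq> (Source, Target)) \<and>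
                (E a b \<longrightarrow> W a b = arc_cost (ring_resistance n \<nu> i) (\<phi> a) (\<phi> b))"])
        subgoal by simp
        subgoal premises outer for A a EW
          apply (rule wp_foreach_set[where B = 11 and
              I = "\<lambda>B (E, W). \<forall>a'\<in>insert a A. \<forall>b\<in>set V. (a' \<in> A \<or> b \<in> B) \<longrightarrow>
                (E a' b \<longleftrightarrow> \<phi> a' < \<phi> b \<and> (a', b) \<noteq> (Source, Target)) \<and>
                (E a' b \<longrightarrow> W a' b = arc_cost (ring_resistance n \<nu> i) (\<phi> a') (\<phi> b))"])
          subgoal using outer by auto
          subgoal premises inner for B b EW'
            using inner(3)
            apply (simp only: wp_bind wp_case_prod split: prod.splits)
            apply (intro allI impI)
            apply (rule wp_spec[OF entry])
            subgoal using outer(1) VU by simp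
            subgoal using inner(1) VU by simp
            subgoal by (auto simp: upd2_apply)
            done
          subgoal by auto
          done
        subgoal premises E for EW r
        proof -
          have "length V * (length V * 12 + 1 + 1) \<le> (n + 2) * ((n + 2) * 12 + 2)"
            using VU(2) by (intro mult_mono) auto
          then show ?thesis
            using E V VU by (auto simp: U_def algebra_simps)
        qed
        done
    qed
    done
qed


section \<open>The modified Bellman-Ford routine\<close>

text \<open>The infimum over the empty set is \<open>\<infinity>\<close>, as in the routine when no
  edge enters \<open>v\<close>.\<close>

fun bf_dist :: "'v set \<Rightarrow> ('v \<Rightarrow> 'v \<Rightarrow> bool) \<Rightarrow> ('v \<Rightarrow> 'v \<Rightarrow> real) \<Rightarrow> 'v \<Rightarrow> nat \<Rightarrow> 'v \<Rightarrow> ereal" where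
  "bf_dist V E W s 0 v = (if v = s then 0 else \<infinity>)"
| "bf_dist V E W s (Suc m) v = (INF u\<in>{u \<in> V. E u v}. bf_dist V E W s m u + ereal (W u v))"

definition walk :: "'v set \<Rightarrow> ('v \<Rightarrow> 'v \<Rightarrow> bool) \<Rightarrow> 'v \<Rightarrow> 'v \<Rightarrow> 'v list \<Rightarrow> bool" where
  "walk V E s t P \<longleftrightarrow> P \<noteq> [] \<and> hd P = s \<and> last P = t \<and> set P \<subseteq> V \<and> successively E P"

lemma path_weight_snoc:
  "P \<noteq> [] \<Longrightarrow> path_weight W (P @ [v]) = path_weight W P + W (last P) v"
  by (induction W P rule: path_weight.induct) auto

text \<open>Induction from the end of the path, as the recursion removes the last edge. That finite
  distances are attained will come from following the recorded predecessors.\<close>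

lemma bf_dist_le_path_weight:
  "walk V E s v P \<Longrightarrow> bf_dist V E W s (length P - 1) v \<le> ereal (path_weight W P)"
proof (induction P arbitrary: v rule: rev_induct)
  case Nil
  then show ?case by (simp add: walk_def)
next
  case (snoc a P)
  show ?case
  proof (cases "P = []")
    case True
    then show ?thesis
      using snoc.prems by (auto simp: walk_def zero_ereal_def)
  next
    case False
    then have P: "walk V E s (last P) P" "last P \<in> V" "E (last P) v" "a = v"
      using snoc.prems by (auto simp: walk_def successively_append_iff)
    obtain m where m: "length P = Suc m"
      using False by (cases P) auto
    have "bf_dist V E W s (Suc m) v \<le> bf_dist V E W s m (last P) + ereal (W (last P) v)"
      using P by (auto intro!: INF_lower2[of "last P"])
    also have "\<dots> \<le> ereal (path_weight W P) + ereal (W (last P) v)"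
      using snoc.IH[OF P(1)] m by (intro add_right_mono) simp
    finally show ?thesis
      using False P m by (simp add: path_weight_snoc)
  qed
qed

lemma Collect_insert_filter:
  "{u \<in> insert x A. P u} = (if P x then insert x {u \<in> A. P u} else {u \<in> A. P u})"
  by auto

lemma bellman_ford_spec:
  assumes s: "s \<in> set V" and t: "t \<in> set V"
  shows "spec (bellman_ford V E W s t H)
    (length V * 3 + H * (length V * (length V * 8 + 4) + 9) + 6)
    (\<lambda>(P, x). (P = [] \<and> x = \<infinity> \<or> walk (set V) E s t P \<and> length P \<le> H + 1 \<and> x = ereal (path_weight W P)) \<and>
      (\<forall>Q. walk (set V) E s t Q \<and> 2 \<le> length Q \<and> length Q \<le> H + 1 \<longrightarrow> x \<le> ereal (path_weight W Q)))"
proof -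
  define D where "D = bf_dist (set V) E W s"
  \<comment> \<open>The predecessor is related to the ideal distances \<open>D\<close>, not to the
    array \<open>d\<close>, so the property is local to one cell and survives writes elsewhere. It
    is claimed only for finite distances, as the predecessor stored with \<open>\<infinity>\<close>
    may be meaningless.\<close>
  define best where "best = (\<lambda>d \<pi> m v. d m v = D m v \<and>
    (0 < m \<and> D m v < \<infinity> \<longrightarrow> \<pi> m v \<in> set V \<and> E (\<pi> m v) v \<and>
      D m v = D (m - 1) (\<pi> m v) + ereal (W (\<pi> m v) v)))"
  have best_upd: "best (upd2 d m v x) (upd2 \<pi> m v p) m' v' \<longleftrightarrow> best d \<pi> m' v'"
    if "m' \<noteq> m \<or> v' \<noteq> v" for d \<pi> m v x p m' v'
    using that by (auto simp: best_def upd2_apply)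
  show ?thesis
    unfolding bellman_ford_def
    apply (rule specI)
    apply (simp only: wp_bind)
    apply (rule wp_foreach_set[where B = 2 and I = "\<lambda>A d. \<forall>v\<in>A. d 0 v = D 0 v"])
    subgoal by simp
    subgoal by (auto simp: upd2_apply D_def)
    subgoal premises init for d t0
      apply (rule wp_foreach_upt[where B = "length V * (length V * 8 + 4) + 1" and
            I = "\<lambda>m (d, \<pi>). \<forall>m'<m. \<forall>v\<in>set V. best d \<pi> m' v"])
      subgoal using init by (simp add: best_def)
      subgoal by simp
      subgoal premises outer for m S
        apply (rule wp_foreach_set[where B = "length V * 8 + 3" and
              I = "\<lambda>A (d, \<pi>). (\<forall>m'<m. \<forall>v\<in>set V. best d \<pi> m' v) \<and> (\<forall>v\<in>A. best d \<pi> m v)"])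
        subgoal using outer by simp
        subgoal premises mid for A v S
        proof (cases S)
          case (Pair d \<pi>)
          have S: "\<forall>m'<m. \<forall>v\<in>set V. best d \<pi> m' v" "\<forall>v\<in>A. best d \<pi> m v"
            using mid(3) by (simp_all add: Pair)
          show ?thesis
            unfolding Pair
            apply (simp only: wp_bind prod.case)
            apply (rule wp_foreach_set[where B = 7 and
                  I = "\<lambda>A (x, p). x = (INF u\<in>{u \<in> A. E u v}. D (m - 1) u + ereal (W u v)) \<and>
                    (x < \<infinity> \<longrightarrow> p \<in> set V \<and> E p v \<and> x = D (m - 1) p + ereal (W p v))"])
            subgoal by (simp add: top_ereal_def)
            subgoal premises inner for B u xp
            proof -
              have "d (m - 1) u = D (m - 1) u"
                using S outer(1) inner(1) by (simp add: best_def)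
              then show ?thesis
                using inner
                by (cases xp; cases "E u v")
                  (auto simp: Collect_insert_filter inf_min min_def not_less simp del: insert_iff)
            qed
            subgoal premises inner for xp r
            proof -
              have m: "m = Suc (m - 1)"
                using outer(1) by simp
              have "D m v = (INF u\<in>{u \<in> set V. E u v}. D (m - 1) u + ereal (W u v))"
                unfolding D_def by (subst m) simp
              then have new: "best (upd2 d m v x) (upd2 \<pi> m v p) m v" if "xp = (x, p)" for x p
                using inner(1) that by (simp add: best_def upd2_apply)
              have "best (upd2 d m v x) (upd2 \<pi> m v p) m v'"
                if "xp = (x, p)" "v' \<in> insert v A" for x p v'
                using new[OF that(1)] S(2) that(2) by (cases "v' = v") (auto simp: best_upd)
              then show ?thesis
                using inner(2) S(1) by (cases xp) (simp add: best_upd)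
            qed
            done
        qed
        subgoal using outer by (auto simp: less_Suc_eq algebra_simps)
        done
      subgoal premises loop for S t1
      proof (cases S)
        case (Pair d \<pi>)
        have S: "\<forall>m'<H + 1. \<forall>v\<in>set V. best d \<pi> m' v"
          using loop(1) by (simp add: Pair)
        show ?thesis
          unfolding Pair
          apply (simp only: wp_bind prod.case)
          apply (rule wp_foreach_upt[where B = 3 and
                I = "\<lambda>m (x, h). x = (INF m'\<in>{1..<m}. D m' t) \<and>
                  (x < \<infinity> \<longrightarrow> 1 \<le> h \<and> h < m \<and> x = D h t)"])
          subgoal by (simp add: top_ereal_def)
          subgoal by simp
          subgoal premises prems for m xh
          proof -
            have "d m t = D m t"
              using S prems t by (simp add: best_def)
            then show ?thesis
              using prems by (cases xh) (auto simp: atLeastLessThanSuc inf_min min_def not_less)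
          qed
          subgoal premises final for xh t2
          proof -
            obtain x h where xh: "xh = (x, h)"
              by (cases xh)
            have lower: "x \<le> ereal (path_weight W Q)"
              if Q: "walk (set V) E s t Q" "2 \<le> length Q" "length Q \<le> H + 1" for Q
            proof -
              have "x \<le> D (length Q - 1) t"
                using final(1) Q by (auto simp: xh intro!: INF_lower)
              also have "\<dots> \<le> ereal (path_weight W Q)"
                unfolding D_def by (rule bf_dist_le_path_weight[OF Q(1)])
              finally show ?thesis .
            qed
            show ?thesis
            proof (cases "x = \<infinity>")
              case True
              moreover have "t2 + 1 \<le> length V * 3 + H * (length V * (length V * 8 + 4) + 9) + 6"
                using final(2) loop(2) init(2) by (simp add: algebra_simps)
              ultimately show ?thesis
                using lower by (auto simp: xh)
            next
              case False
              then have h: "1 \<le> h" "h \<le> H" "x = D h t"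
                using final(1) by (auto simp: xh)
              show ?thesis
                unfolding xh
                apply (simp only: wp_bind wp_step wp_if prod.case False if_False)
                \<comment> \<open>The recovered suffix and the distance \<open>D (m - 1) v\<close>
                  still to be covered always add up to \<open>x\<close>.\<close>
                apply (rule wp_foreach_rev_upt[where B = 2 and
                      I = "\<lambda>m (v, P). walk (set V) E v t P \<and> length P = h + 2 - m \<and>
                        D (m - 1) v < \<infinity> \<and> x = D (m - 1) v + ereal (path_weight W P)"])
                subgoal using h False t by (simp add: walk_def)
                subgoal using h by simp
                subgoal premises prems for m vP
                proof -
                  obtain v P where vP: "vP = (v, P)"
                    by (cases vP)
                  have P: "walk (set V) E v t P" "D m v < \<infinity>" "x = D m v + ereal (path_weight W P)"
                    using prems(3) by (auto simp: vP)
                  have "best d \<pi> m v"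
                    using S prems(1,2) h P(1) hd_in_set[of P] by (auto simp: walk_def)
                  then have u: "\<pi> m v \<in> set V" "E (\<pi> m v) v"
                      "D m v = D (m - 1) (\<pi> m v) + ereal (W (\<pi> m v) v)"
                    using prems P(2) by (auto simp: best_def)
                  then have "D (m - 1) (\<pi> m v) < \<infinity>"
                    using P(2) by auto
                  moreover have "walk (set V) E (\<pi> m v) t (\<pi> m v # P)"
                    using u P(1) by (auto simp: walk_def successively_Cons)
                  moreover have "path_weight W (\<pi> m v # P) = W (\<pi> m v) v + path_weight W P"
                    using P(1) by (cases P) (auto simp: walk_def)
                  ultimately show ?thesis
                    using prems h u P(3) by (simp add: vP add.assoc)
                qed
                subgoal premises prems for vP r
                proof -
                  obtain v P where vP: "vP = (v, P)"
                    by (cases vP)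
                  have P: "walk (set V) E v t P" "length P = h + 1" "D 0 v < \<infinity>"
                      "x = D 0 v + ereal (path_weight W P)"
                    using prems(1) by (auto simp: vP)
                  \<comment> \<open>At \<open>0\<close> edges only the source has a finite distance,
                    so the recovery must have arrived there.\<close>
                  then have "v = s" "D 0 v = 0"
                    by (auto simp: D_def split: if_splits)
                  moreover have "r \<le> length V * 3 + H * (length V * (length V * 8 + 4) + 9) + 6"
                    using prems(2) h(2) final(2) loop(2) init(2) by (simp add: algebra_simps)
                  ultimately show ?thesis
                    using P h lower by (simp add: vP)
                qed
                done
            qed
          qed
          done
      qed
      done
    done
qed


section \<open>Optimality of the selected leaders\<close>

text \<open>Moving a grounded end closer to \<open>q\<close> lowers its resistance to ground, and
  the new leader \<open>d\<close> drops its own nonnegative term.\<close>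

lemma arc_cost_split:
  assumes R: "strict_mono R" and d: "a < d" "d < b"
  shows "arc_cost R a d + arc_cost R d b \<le> arc_cost R a b"
proof -
  have less: "R p < R q" if "p < q" for p q
    using strict_monoD[OF R that] .
  define f where "f = (\<lambda>q. (R q - R a) * (R b - R q) / (R b - R a))"
  have left: "(R q - R a) * (R d - R q) / (R d - R a) \<le> f q" if "q \<in> {a<..<d}" for q
  proof -
    have pos: "0 < R q - R a" "0 < R d - R a" "0 < R b - R a" "R d < R b"
      using less that d by auto
    \<comment> \<open>As one minus a ratio, the second factor visibly grows when the right end moves
      away.\<close>
    have "(R d - R q) / (R d - R a) = 1 - (R q - R a) / (R d - R a)"
        "(R b - R q) / (R b - R a) = 1 - (R q - R a) / (R b - R a)"
      using pos by (simp_all add: field_simps)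
    moreover have "(R q - R a) / (R b - R a) \<le> (R q - R a) / (R d - R a)"
      using pos by (intro divide_left_mono) auto
    ultimately have "(R q - R a) * ((R d - R q) / (R d - R a)) \<le> (R q - R a) * ((R b - R q) / (R b - R a))"
      using pos by (intro mult_left_mono) auto
    then show ?thesis
      by (simp add: f_def)
  qed
  have right: "(R q - R d) * (R b - R q) / (R b - R d) \<le> f q" if "q \<in> {d<..<b}" for q
  proof -
    have pos: "0 < R b - R q" "0 < R b - R d" "0 < R b - R a" "R a < R d"
      using less that d by auto
    have "(R q - R d) / (R b - R d) = 1 - (R b - R q) / (R b - R d)"
        "(R q - R a) / (R b - R a) = 1 - (R b - R q) / (R b - R a)"
      using pos by (simp_all add: field_simps)
    moreover have "(R b - R q) / (R b - R a) \<le> (R b - R q) / (R b - R d)"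
      using pos by (intro divide_left_mono) auto
    ultimately have "((R q - R d) / (R b - R d)) * (R b - R q) \<le> ((R q - R a) / (R b - R a)) * (R b - R q)"
      using pos by (intro mult_right_mono) auto
    then show ?thesis
      by (simp add: f_def)
  qed
  have "0 \<le> f d"
    unfolding f_def using less[of a d] less[of d b] less[of a b] d by simp
  have "{a<..<b} = {a<..<d} \<union> insert d {d<..<b}"
    using d by auto
  then have "arc_cost R a b = (\<Sum>q\<in>{a<..<d} \<union> insert d {d<..<b}. f q)"
    by (simp add: arc_cost_def f_def)
  also have "\<dots> = (\<Sum>q\<in>{a<..<d}. f q) + (\<Sum>q\<in>insert d {d<..<b}. f q)"
    by (rule sum.union_disjoint) auto
  also have "\<dots> = (\<Sum>q\<in>{a<..<d}. f q) + (f d + (\<Sum>q\<in>{d<..<b}. f q))"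
    by simp
  finally have split: "arc_cost R a b = (\<Sum>q\<in>{a<..<d}. f q) + (f d + (\<Sum>q\<in>{d<..<b}. f q))" .
  have "arc_cost R a d \<le> (\<Sum>q\<in>{a<..<d}. f q)"
    unfolding arc_cost_def by (rule sum_mono) (rule left)
  moreover have "arc_cost R d b \<le> (\<Sum>q\<in>{d<..<b}. f q)"
    unfolding arc_cost_def by (rule sum_mono) (rule right)
  ultimately show ?thesis
    using split \<open>0 \<le> f d\<close> by linarith
qed

lemma total_variance_insert_le:
  assumes net: "ring_network n \<nu>" and i: "i \<in> {1..n}" "v \<in> {1..n}" "v \<noteq> i"
  shows "total_variance n \<nu> {i, v} \<le> total_variance n \<nu> {i}"
proof -
  define d where "d = ring_offset n i v"
  have d: "0 < d" "d < n" "ring_node n i d = v"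
    using i ring_offset_eq_0_iff[of i n v] ring_offset_less[of n i v] by (auto simp: d_def ring_node_offset)
  have "total_variance n \<nu> {i, v} = 1 / 2 * path_weight (arc_cost (ring_resistance n \<nu> i)) [0, d, n]"
    using total_variance_eq_path_weight[OF net i(1), of "[0, d, n]"] d i
    by (simp add: ring_node_0 ring_node_self insert_commute)
  moreover have "total_variance n \<nu> {i} = 1 / 2 * path_weight (arc_cost (ring_resistance n \<nu> i)) [0, n]"
    using total_variance_eq_path_weight[OF net i(1), of "[0, n]"] d i
    by (simp add: ring_node_0 ring_node_self)
  ultimately show ?thesis
    using arc_cost_split[OF ring_resistance_strict_mono[OF net i(1)] d(1,2)] by simp
qed

lemma path_weight_map:
  "successively (\<lambda>a b. W a b = W' (f a) (f b)) P \<Longrightarrow> path_weight W P = path_weight W' (map f P)"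
  by (induction W P rule: path_weight.induct) auto

section \<open>Paths in the digraph and leader sets\<close>

text \<open>The guarantees of \<open>ring_digraph_spec\<close> detached from the program. Weights
  are fixed only on edges, as the other entries are placeholders.\<close>

locale ring_digraph =
  fixes n \<nu> i V E W
  assumes net: "ring_network n \<nu>" and i: "i \<in> {1..n}"
    and V: "V = {Source, Target} \<union> Node ` ({1..n} - {i})"
    and E: "\<And>a b. a \<in> V \<Longrightarrow> b \<in> V \<Longrightarrow>
      E a b \<longleftrightarrow> vertex_offset n i a < vertex_offset n i b \<and> (a, b) \<noteq> (Source, Target)"
    and W: "\<And>a b. a \<in> V \<Longrightarrow> b \<in> V \<Longrightarrow> E a b \<Longrightarrow>
      W a b = arc_cost (ring_resistance n \<nu> i) (vertex_offset n i a) (vertex_offset n i b)"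
begin

lemma ring_node_vertex_offset:
  "a \<in> V \<Longrightarrow> ring_node n i (vertex_offset n i a) = (case a of Node v \<Rightarrow> v | _ \<Rightarrow> i)"
  using i by (auto simp: V ring_node_0 ring_node_self ring_node_offset)

text \<open>Offsets increase strictly along a walk, so they form a list of the kind required by
  \<open>total_variance_eq_path_weight\<close>. The factor 2 undoes the one half in the
  variance.\<close>

lemma path_weight_eq_total_variance:
  assumes P: "walk V E Source Target P"
  shows "path_weight W P = 2 * total_variance n \<nu> (insert i {v. Node v \<in> set P})"
proof -
  have PV: "set P \<subseteq> V" and P0: "P \<noteq> []" "hd P = Source" "last P = Target"
    using P by (auto simp: walk_def)
  have "successively (\<lambda>a b. vertex_offset n i a < vertex_offset n i b \<and>
      W a b = arc_cost (ring_resistance n \<nu> i) (vertex_offset n i a) (vertex_offset n i b)) P"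
  proof (rule successively_mono)
    show "successively E P"
      using P by (simp add: walk_def)
  qed (use PV E W in blast)
  then have 1: "successively (\<lambda>a b. W a b = arc_cost (ring_resistance n \<nu> i) (vertex_offset n i a) (vertex_offset n i b)) P"
    and 2: "successively (<) (map (vertex_offset n i) P)"
    by (auto simp: successively_map elim!: successively_mono)
  have "ring_node n i ` set (map (vertex_offset n i) P) = insert i {v. Node v \<in> set P}"
  proof -
    have "Source \<in> set P"
      using P0 hd_in_set[of P] by simp
    have "ring_node n i ` set (map (vertex_offset n i) P) = (\<lambda>a. case a of Node v \<Rightarrow> v | _ \<Rightarrow> i) ` set P"
      using PV ring_node_vertex_offset by (auto simp: image_image intro!: image_cong)
    also have "\<dots> = insert i {v. Node v \<in> set P}"
      using \<open>Source \<in> set P\<close> by (force split: vertex.splits)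
    finally show ?thesis .
  qed
  moreover have "sorted_wrt (<) (map (vertex_offset n i) P)"
    using 2 by (simp add: successively_conv_sorted_wrt)
  ultimately show ?thesis
    using total_variance_eq_path_weight[OF net i, of "map (vertex_offset n i) P"] P0
    by (simp add: path_weight_map[where f = "vertex_offset n i", OF 1] hd_map last_map)
qed

text \<open>The members of \<open>T\<close> other than \<open>i\<close> are visited in clockwise
  order. At least one is needed, since no edge leads from source to target; \<open>i\<close> takes
  two places of the walk, so it has \<open>card T\<close> edges.\<close>

lemma walk_exists:
  assumes T: "i \<in> T" "T \<subseteq> {1..n}" "2 \<le> card T"
  obtains Q where "walk V E Source Target Q" "length Q = card T + 1" "insert i {v. Node v \<in> set Q} = T"
proof -
  define os where "os = sorted_list_of_set (ring_offset n i ` (T - {i}))"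
  have fin: "finite T"
    using T(2) finite_subset by blast
  have inj: "inj_on (ring_offset n i) T"
    using ring_node_offset[OF i] T(2) by (intro inj_on_inverseI[where g = "ring_node n i"]) auto
  have set_os: "set os = ring_offset n i ` (T - {i})"
    unfolding os_def using fin by simp
  have len: "length os = card T - 1"
    unfolding os_def using fin inj T by (simp add: card_image inj_on_diff)
  have sorted: "sorted_wrt (<) os"
    unfolding os_def by simp
  have os_mem: "0 < p" "p < n" "ring_node n i p \<in> T - {i}" if "p \<in> set os" for p
    using that T i ring_offset_eq_0_iff[OF i] ring_offset_less[of n i] ring_node_offset[OF i]
    unfolding set_os by force+
  have img: "ring_node n i ` set os = T - {i}"
    using ring_node_offset[OF i] T(2) by (force simp: set_os image_image)
  define N where "N = (\<lambda>p. Node (ring_node n i p))"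
  define Q where "Q = Source # map N os @ [Target]"
  have NV: "N p \<in> V" "vertex_offset n i (N p) = p" if "p \<in> set os" for p
    using os_mem[OF that] T i by (auto simp: N_def V ring_offset_node)
  have "os \<noteq> []"
    using len T(3) by auto
  have SV: "Source \<in> V" "Target \<in> V"
    by (auto simp: V)
  have "successively (\<lambda>p q. E (N p) (N q)) os"
    using sorted_wrt_less_successively[OF sorted]
    by (rule successively_mono) (use E NV in \<open>auto simp: N_def\<close>)
  moreover have "E Source (N (hd os))" "E (N (last os)) Target"
    using \<open>os \<noteq> []\<close> os_mem[of "hd os"] os_mem[of "last os"] SV NV
    by (auto simp: E) (auto simp: N_def)
  ultimately have "successively E Q"
    using \<open>os \<noteq> []\<close>
    by (auto simp: Q_def successively_Cons successively_append_iff successively_map hd_append hd_map last_map)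
  then have "walk V E Source Target Q"
    using NV SV by (auto simp: walk_def Q_def)
  moreover have "length Q = card T + 1"
    using len T(3) by (simp add: Q_def)
  moreover have "insert i {v. Node v \<in> set Q} = T"
    using img T(1) by (auto simp: Q_def N_def image_iff)
  ultimately show thesis by (rule that)
qed

end

text \<open>What the search from the initial leader \<open>i\<close> returns: \<open>p\<close> is its path and \<open>x\<close> its weight.\<close>

definition best_from :: "nat \<Rightarrow> (nat \<Rightarrow> nat \<Rightarrow> real) \<Rightarrow> nat \<Rightarrow> nat \<Rightarrow> vertex list \<Rightarrow> ereal \<Rightarrow> bool" where
  "best_from n \<nu> k i p x \<longleftrightarrow>
     length p \<le> k + 1 \<and>
     insert i {v. Node v \<in> set p} \<subseteq> {1..n} \<and> card (insert i {v. Node v \<in> set p}) \<le> k \<and>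
     (k \<ge> 2 \<longrightarrow> x = ereal (2 * total_variance n \<nu> (insert i {v. Node v \<in> set p}))) \<and>
     (\<forall>T. i \<in> T \<and> T \<subseteq> {1..n} \<and> 2 \<le> card T \<and> card T \<le> k \<longrightarrow>
        x \<le> ereal (2 * total_variance n \<nu> T))"

lemma (in ring_digraph) best_from_bellman_ford:
  assumes k: "k \<ge> 1"
    and p: "p = [] \<and> x = \<infinity> \<or> walk V E Source Target p \<and> length p \<le> k + 1 \<and> x = ereal (path_weight W p)"
    and lower: "\<And>Q. walk V E Source Target Q \<Longrightarrow> 2 \<le> length Q \<Longrightarrow> length Q \<le> k + 1 \<Longrightarrow>
      x \<le> ereal (path_weight W Q)"
  shows "best_from n \<nu> k i p x"
proof -
  have n: "n \<ge> 3"
    using net by (simp add: ring_network_def)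
  have opt: "x \<le> ereal (2 * total_variance n \<nu> T)"
    if T: "i \<in> T" "T \<subseteq> {1..n}" "2 \<le> card T" "card T \<le> k" for T
  proof -
    obtain Q where Q: "walk V E Source Target Q" "length Q = card T + 1" "insert i {v. Node v \<in> set Q} = T"
      using walk_exists[OF T(1-3)] .
    then show ?thesis
      using lower[OF Q(1)] T path_weight_eq_total_variance[OF Q(1)] by simp
  qed
  \<comment> \<open>A second node exists, and the pair it forms with \<open>i\<close> bounds the
    distance by a real number.\<close>
  have finite: "x \<noteq> \<infinity>" if "k \<ge> 2"
  proof -
    obtain v where "v \<in> {1..n}" "v \<noteq> i"
    proof (cases "i = 1")
      case True
      then show ?thesis using n that[of 2] by simp
    next
      case False
      then show ?thesis using n that[of 1] by simp
    qed
    then show ?thesis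
      using opt[of "{i, v}"] i \<open>k \<ge> 2\<close> by auto
  qed
  show ?thesis
  proof (cases "p = []")
    case True
    then show ?thesis
      using finite p opt i k by (auto simp: best_from_def walk_def)
  next
    case False
    then have P: "walk V E Source Target p" "length p \<le> k + 1" "x = ereal (path_weight W p)"
      using p by auto
    then have PV: "set p \<subseteq> V" and ST: "Source \<in> set p" "Target \<in> set p"
      using False hd_in_set[OF False] last_in_set[OF False] by (auto simp: walk_def)
    \<comment> \<open>Of at most \<open>k + 1\<close> vertices two are source and target; the other
      \<open>k - 1\<close> at most, together with \<open>i\<close>, give at most \<open>k\<close>
      leaders.\<close>
    have "Node ` {v. Node v \<in> set p} \<subseteq> set p - {Source, Target}"
      by auto
    then have "card (Node ` {v. Node v \<in> set p}) \<le> card (set p - {Source, Target})"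
      by (intro card_mono) auto
    also have "card (set p - {Source, Target}) = card (set p) - 2"
      using ST by (subst card_Diff_subset) auto
    also have "\<dots> \<le> k - 1"
      using card_length[of p] P(2) by linarith
    finally have "card {v. Node v \<in> set p} \<le> k - 1"
      by (subst (asm) card_image) (auto simp: inj_on_def)
    then have "card (insert i {v. Node v \<in> set p}) \<le> k"
      using k card_insert_le_m1[of k "{v. Node v \<in> set p}" i] by simp
    moreover have "insert i {v. Node v \<in> set p} \<subseteq> {1..n}"
      using PV i by (auto simp: V)
    ultimately show ?thesis
      using P opt path_weight_eq_total_variance[OF P(1)] by (simp add: best_from_def)
  qed
qed

section \<open>The whole algorithm and its running time\<close>

lemma ring_leader_selection_spec:
  assumes net: "ring_network n \<nu>" and k: "k \<ge> 1"
  shows "spec (ring_leader_selection n (\<lambda>i j. 1 / \<nu> i j) k)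
    ((n * (n * 12 + 3) + 1) + (n * (n * (n * 11 + 2) + n * (30 * n + 12) + 4) + 1) +
     (n * ((n * 3 + (n + 2) * ((n + 2) * 13 + 2) + 2) +
           ((n + 2) * 3 + k * ((n + 2) * ((n + 2) * 8 + 4) + 9) + 6) + 3) + 1) + n * 4 + 2 * k + 6)
    (\<lambda>(S, x). \<exists>i p. i \<in> {1..n} \<and> set S = insert i {v. Node v \<in> set p} \<and> best_from n \<nu> k i p x \<and>
      (\<forall>T. T \<noteq> {} \<and> T \<subseteq> {1..n} \<and> 2 \<le> card T \<and> card T \<le> k \<longrightarrow> x \<le> ereal (2 * total_variance n \<nu> T)))"
proof -
  have n: "n \<ge> 3"
    using net by (simp add: ring_network_def)
  show ?thesis
    unfolding ring_leader_selection_def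
    apply (rule specI)
    apply (simp only: wp_bind wp_step)
    apply (rule wp_spec[OF laplacian_table_spec])
    subgoal premises L for L t0
      apply (rule wp_spec[OF weight_table_spec[OF net L(1)]])
      subgoal premises w for w t1
        apply (rule wp_foreach_upt[where
              B = "(n * 3 + (n + 2) * ((n + 2) * 13 + 2) + 2) +
                ((n + 2) * 3 + k * ((n + 2) * ((n + 2) * 8 + 4) + 9) + 6) + 2" and
              I = "\<lambda>j (P, \<omega>). \<forall>i\<in>{1..<j}. best_from n \<nu> k i (P i) (\<omega> i)"])
        subgoal by simp
        subgoal by simp
        subgoal premises body for i S
        proof (cases S)
          case (Pair P \<omega>)
          have i: "i \<in> {1..n}"
            using body by simp
          show ?thesis
            unfolding Pair
            apply (simp only: wp_bind wp_step prod.case)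
            apply (rule wp_spec[OF ring_digraph_spec[OF i w(1)]])
            subgoal premises G for VEW t2
            proof (cases VEW)
              case (fields V E W)
              interpret ring_digraph n \<nu> i "set V" E W
                by unfold_locales (use net i G(1) in \<open>auto simp: fields\<close>)
              have V: "Source \<in> set V" "Target \<in> set V" "length V \<le> n + 2"
                using G(1) by (auto simp: fields)
              have "length V * 3 + k * (length V * (length V * 8 + 4) + 9) \<le>
                  (n + 2) * 3 + k * ((n + 2) * ((n + 2) * 8 + 4) + 9)"
                using V(3) by (intro add_mono mult_mono) auto
              note time = this G(2)
              show ?thesis
                unfolding fields
                apply (simp only: wp_bind wp_step prod.case)
                apply (rule wp_spec[OF bellman_ford_spec[OF V(1,2)]])
                subgoal premises BF for px t3
                  using BF body(3) best_from_bellman_ford[OF k, of "fst px" "snd px"] time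
                  by (cases px) (auto simp: Pair less_Suc_eq)
                done
            qed
            done
        qed
        subgoal premises loop for S t2
        proof (cases S)
          case (Pair P \<omega>)
          have good: "best_from n \<nu> k i (P i) (\<omega> i)" if "i \<in> {1..n}" for i
            using loop(1) that by (simp add: Pair)
          show ?thesis
            unfolding Pair
            apply (simp only: wp_bind wp_step prod.case)
            apply (rule wp_foreach_upt[where B = 3 and
                  I = "\<lambda>j (i, x). 1 \<le> i \<and> i < j \<and> x = \<omega> i \<and> (\<forall>i'\<in>{1..<j}. x \<le> \<omega> i')"])
            subgoal by (auto simp: numeral_2_eq_2 less_Suc_eq)
            subgoal using n by simp
            subgoal premises prems for j ix
              using prems by (cases ix) (auto simp: less_Suc_eq not_less intro: order_trans)
            subgoal premises fin for ix t3
            proof (cases ix)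
              case (Pair i x)
              have i: "i \<in> {1..n}" "x = \<omega> i" and min: "x \<le> \<omega> i'" if "i' \<in> {1..n}" for i'
                using fin(1) that by (auto simp: Pair)
              have i: "i \<in> {1..n}" "x = \<omega> i"
                using i[of 1] n by auto
              have opt: "x \<le> ereal (2 * total_variance n \<nu> T)"
                if T: "T \<noteq> {}" "T \<subseteq> {1..n}" "2 \<le> card T" "card T \<le> k" for T
              proof -
                \<comment> \<open>Any member of \<open>T\<close> can act as initial leader, and the
                  search from it has taken \<open>T\<close> into account.\<close>
                obtain i' where i': "i' \<in> T" "i' \<in> {1..n}"
                  using T by blast
                have "\<omega> i' \<le> ereal (2 * total_variance n \<nu> T)"
                  using good[OF i'(2)] i' T unfolding best_from_def by blast
                then show ?thesis
                  using min[OF i'(2)] by (rule order_trans[rotated])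
              qed
              have "length (P i) \<le> k + 1"
                using good[OF i(1)] by (simp add: best_from_def)
              note time = this fin(2) loop(2) w(2) L(2)
              show ?thesis
                unfolding Pair
                apply (simp only: wp_bind wp_step prod.case)
                apply (rule wp_foreach_set[where B = 1 and I = "\<lambda>A S. set S = insert i {v. Node v \<in> A}"])
                subgoal by simp
                subgoal for A a S by (cases a) auto
                subgoal premises prems for S t4
                proof -
                  have "best_from n \<nu> k i (P i) x"
                    using good[OF i(1)] i(2) by simp
                  then have "\<exists>i p. i \<in> {1..n} \<and> set S = insert i {v. Node v \<in> set p} \<and>
                      best_from n \<nu> k i p x"
                    using prems(1) i(1) by blast
                  then show ?thesis
                    using opt prems(2) time by (simp add: algebra_simps)
                qed
                done
            qed
            done
        qed
        done
      done
    done
qed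

lemma cubic_time_bound:
  fixes n k :: nat
  assumes n: "n \<ge> 1" and k: "k \<ge> 1"
  shows "(n * (n * 12 + 3) + 1) + (n * (n * (n * 11 + 2) + n * (30 * n + 12) + 4) + 1) +
     (n * ((n * 3 + (n + 2) * ((n + 2) * 13 + 2) + 2) +
           ((n + 2) * 3 + k * ((n + 2) * ((n + 2) * 8 + 4) + 9) + 6) + 3) + 1) + n * 4 + 2 * k + 6
     \<le> 1000 * (k * n ^ 3)" (is "?t \<le> _")
proof -
  have "n ^ a * k ^ b \<le> n ^ 3 * k ^ 1" if "a \<le> 3" "b \<le> 1" for a b
    using n k that by (intro mult_mono power_increasing) auto
  from this[of 0 0] this[of 1 0] this[of 2 0] this[of 3 0] this[of 0 1] this[of 1 1] this[of 2 1]
  have "1 \<le> n ^ 3 * k" "n \<le> n ^ 3 * k" "n ^ 2 \<le> n ^ 3 * k" "n ^ 3 \<le> n ^ 3 * k"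
    "k \<le> n ^ 3 * k" "n * k \<le> n ^ 3 * k" "n ^ 2 * k \<le> n ^ 3 * k"
    by (simp_all del: One_nat_def)
  \<comment> \<open>Each monomial is at most \<open>n ^ 3 * k\<close>, and the coefficients sum to
    328; 1000 is a round number above that.\<close>
  moreover have "?t = 8 * (n ^ 3 * k) + 54 * n ^ 3 + 36 * (n ^ 2 * k) + 86 * n ^ 2 + 49 * (n * k) +
      84 * n + 2 * k + 9"
    by (simp add: algebra_simps power2_eq_square power3_eq_cube)
  ultimately show ?thesis
    by (simp only: mult.commute[of k])
qed

theorem theorem2:
  shows "(\<forall>n \<nu> k. ring_network n \<nu> \<and> k \<ge> 1 \<longrightarrow>
            execs (ring_leader_selection n (\<lambda>i j. 1 / \<nu> i j) k) \<noteq> {} \<and>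
            (\<forall>((S, w), t) \<in> execs (ring_leader_selection n (\<lambda>i j. 1 / \<nu> i j) k).
               set S \<subseteq> {1..n} \<and> set S \<noteq> {} \<and> card (set S) \<le> k \<and>
               (k \<ge> 2 \<longrightarrow> (\<forall>T. T \<subseteq> {1..n} \<and> T \<noteq> {} \<and> card T \<le> k \<longrightarrow>
                  total_variance n \<nu> (set S) \<le> total_variance n \<nu> T))))
       \<and> (\<exists>C::nat. \<forall>n \<nu> k. ring_network n \<nu> \<and> k \<ge> 1 \<longrightarrow>
            (\<forall>((S, w), t) \<in> execs (ring_leader_selection n (\<lambda>i j. 1 / \<nu> i j) k).
               t \<le> C * (k * n ^ 3)))"
proof -
  have main: "set S \<subseteq> {1..n} \<and> set S \<noteq> {} \<and> card (set S) \<le> k \<and>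
      (k \<ge> 2 \<longrightarrow> (\<forall>T. T \<subseteq> {1..n} \<and> T \<noteq> {} \<and> card T \<le> k \<longrightarrow>
        total_variance n \<nu> (set S) \<le> total_variance n \<nu> T)) \<and> t \<le> 1000 * (k * n ^ 3)"
    if net: "ring_network n \<nu>" and k: "k \<ge> 1"
      and run: "((S, w), t) \<in> execs (ring_leader_selection n (\<lambda>i j. 1 / \<nu> i j) k)"
    for n \<nu> k S w t
  proof -
    have n: "n \<ge> 3"
      using net by (simp add: ring_network_def)
    note result = ring_leader_selection_spec[OF net k, unfolded spec_def, rule_format, OF run]
    have "t \<le> 1000 * (k * n ^ 3)"
      using result cubic_time_bound[of n k] n k by linarith
    obtain i p where S: "set S = insert i {v. Node v \<in> set p}" and best: "best_from n \<nu> k i p w"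
      and opt: "\<And>T. T \<noteq> {} \<Longrightarrow> T \<subseteq> {1..n} \<Longrightarrow> 2 \<le> card T \<Longrightarrow> card T \<le> k \<Longrightarrow>
        w \<le> ereal (2 * total_variance n \<nu> T)"
      using result by auto
    have "total_variance n \<nu> (set S) \<le> total_variance n \<nu> T"
      if k2: "k \<ge> 2" and T: "T \<subseteq> {1..n}" "T \<noteq> {}" "card T \<le> k" for T
    proof -
      have w: "w = ereal (2 * total_variance n \<nu> (set S))"
        using best k2 by (simp add: best_from_def S)
      show ?thesis
      proof (cases "card T \<ge> 2")
        case True
        then show ?thesis
          using opt[OF T(2,1) _ T(3)] by (simp add: w)
      next
        \<comment> \<open>Single leaders escape the search, so \<open>T\<close> is first enlarged by
          some node \<open>v\<close>, which exists as \<open>n \<ge> 3\<close>;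
          \<open>k \<ge> 2\<close> leaves room for it.\<close>
        case False
        have "finite T"
          using T(1) finite_subset by blast
        then have "card T = 1"
          using T(2) False by (simp add: card_eq_0_iff le_antisym not_less_eq_eq numeral_2_eq_2 Suc_le_eq card_gt_0_iff)
        then obtain j where j: "T = {j}"
          by (rule card_1_singletonE)
        obtain v where v: "v \<in> {1..n}" "v \<noteq> j"
        proof (cases "j = 1")
          case True
          then show ?thesis using n that[of 2] by simp
        next
          case False
          then show ?thesis using n that[of 1] by simp
        qed
        have "total_variance n \<nu> (set S) \<le> total_variance n \<nu> {j, v}"
          using opt[of "{j, v}"] v T j k2 by (simp add: w)
        also have "\<dots> \<le> total_variance n \<nu> T"
          using total_variance_insert_le[OF net, of j v] v T j by simp
        finally show ?thesis .
      qed
    qed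
    then show ?thesis
      using best \<open>t \<le> 1000 * (k * n ^ 3)\<close> by (auto simp: best_from_def S)
  qed
  show ?thesis
  proof (intro conjI exI[of _ 1000] allI impI)
    fix n \<nu> k
    assume *: "ring_network n \<nu> \<and> 1 \<le> (k::nat)"
    show "execs (ring_leader_selection n (\<lambda>i j. 1 / \<nu> i j) k) \<noteq> {}"
      by (rule execs_ring_leader_selection)
    show "\<forall>((S, w), t) \<in> execs (ring_leader_selection n (\<lambda>i j. 1 / \<nu> i j) k).
        set S \<subseteq> {1..n} \<and> set S \<noteq> {} \<and> card (set S) \<le> k \<and>
        (k \<ge> 2 \<longrightarrow> (\<forall>T. T \<subseteq> {1..n} \<and> T \<noteq> {} \<and> card T \<le> k \<longrightarrow>
          total_variance n \<nu> (set S) \<le> total_variance n \<nu> T))"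
      using main * by blast
    show "\<forall>((S, w), t) \<in> execs (ring_leader_selection n (\<lambda>i j. 1 / \<nu> i j) k). t \<le> 1000 * (k * n ^ 3)"
      using main * by blast
  qed
qed

end
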